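(* Let the uniform mixing Assumption C hold and let $x(t)$ be defined by the Ergodic Mirror Descent (EMD) update with non-increasing stepsize sequence $\{\alpha(t)\}$. Let $x^\star\in X$ be arbitrary and let the compactness condition $D_\psi(x,y)\le\frac12R^2$ ($x,y\in X$) hold. If Assumption A (finite single-step variance, constant $G$) holds, then for any $\epsilon>0$, $$\mathbb{E}\Big[\sum_{t=1}^T \big(f(x(t))-f(x^\star)\big)\Big]\le \frac{R^2}{2\alpha(T)}+\frac{G^2}{2}\sum_{t=1}^T\alpha(t)+3T\epsilon GR+(\tau_{\mathrm{hel}}(P,\epsilon)-1)\Big[G^2\sum_{t=1}^T\alpha(t)+RG\Big],$$ while if Assumption B (Lipschitz, constant $G$) holds, then for any $\epsilon>0$, $$\mathbb{E}\Big[\sum_{t=1}^T \big(f(x(t))-f(x^\star)\big)\Big]\le \frac{R^2}{2\alpha(T)}+\frac{G^2}{2}\sum_{t=1}^T\alpha(t)+T\epsilon GR+(\tau_{\mathrm{TV}}(P,\epsilon)-1)\Big[G^2\sum_{t=1}^T\alpha(t)+RG\Big].$$ The expectation in both bounds is taken with respect to the samples $\xi_1,\dots,\xi_T$.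
   Context: Setting. $\Pi$ is a probability distribution on a sample space $\Xi$, and $X\subseteq\mathbb{R}^d$ is a compact convex set. $\{F(\cdot;\xi):\xi\in\Xi\}$ is a collection of closed convex functions whose domains contain $X$, and $f:X\to\mathbb{R}$ is $f(x)=\mathbb{E}_\Pi[F(x;\xi)]$. $\mathsf g(x;\xi)\in\partial F(x;\xi)$ is a fixed measurable selection of subgradients. $\|\cdot\|$ is a norm with dual norm $\|z\|_*=\sup_{\|x\|\le1}\langle z,x\rangle$. The function $\psi$ is differentiable and convex on $X$ and $1$-strongly convex with respect to $\|\cdot\|$ over $X$: $\psi(y)\ge\psi(x)+\langle\nabla\psi(x),y-x\rangle+\frac12\|x-y\|^2$ for $x,y\in X$. Put $D_\psi(x,y)=\psi(x)-\psi(y)-\langle\nabla\psi(y),x-y\rangle$; $R<\infty$ is such that $D_\psi(x,y)\le\frac12R^2$ for all $x,y\in X$. $\xi_1,\xi_2,\dots$ is a $\Xi$-valued stochastic process with law $P$ (neither Markov nor time-homogeneous in general), and $\mathcal F_t=\sigma(\xi_1,\dots,\xi_t)$. EMD: $x(1)\in X$ is arbitrary, and with stepsizes $\alpha(t)>0$, $$g(t)=\mathsf g(x(t);\xi_t),\qquad x(t+1)=\operatorname{argmin}_{x\in X}\Big\{\langle g(t),x\rangle+\tfrac1{\alpha(t)}D_\psi(x,x(t))\Big\}.$$ Assumption A: there is a constant $G<\infty$ such that, for $x$ ($X$-valued) measurable with respect to $\mathcal F_{t-1}$, with probability 1, $\mathbb{E}[\|\mathsf g(x;\xi_t)\|_*^2\mid\mathcal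 F_{t-1}]\le G^2$. Assumption B: for $\Pi$-almost every $\xi$, $F(\cdot;\xi)$ is $G$-Lipschitz over $X$ with respect to $\|\cdot\|$: $|F(x;\xi)-F(y;\xi)|\le G\|x-y\|$ for $x,y\in X$. Distances: for probability distributions $Q_1,Q_2$ with densities $q_1,q_2$ with respect to a measure $\mu$, $d_{\mathrm{TV}}(Q_1,Q_2)=\int|q_1-q_2|\,d\mu$ (no factor $1/2$) and $d_{\mathrm{hel}}(Q_1,Q_2)^2=\int(\sqrt{q_1}-\sqrt{q_2})^2d\mu$. Mixing times: $P^t_{[s]}$ is the distribution of $\xi_t$ conditioned on $\mathcal F_s$. $\tau_{\mathrm{TV}}(P_{[s]},\epsilon)$ is the smallest $t\in\mathbb{N}$ such that $d_{\mathrm{TV}}(P^{s+t}_{[s]},\Pi)\le\epsilon$, and $\tau_{\mathrm{hel}}(P_{[s]},\epsilon)$ is the smallest $t\in\mathbb{N}$ such that $d_{\mathrm{hel}}(P^{s+t}_{[s]},\Pi)\le\epsilon$ (an i.i.d. process from $\Pi$ has mixing times equal to 1). Assumption C (uniform mixing): there exist uniform mixing times $\tau_{\mathrm{TV}}(P,\epsilon),\tau_{\mathrm{hel}}(P,\epsilon)<\infty$ such that, with probability 1, $\tau_{\mathrm{TV}}(P,\epsilon)\ge\tau_{\mathrm{TV}}(P_{[s]},\epsilon)$ and $\tau_{\mathrm{hel}}(P,\epsilon)\ge\tau_{\mathrm{hel}}(P_{[s]},\epsilon)$ for all $\epsilon>0$ and $s\in\mathbb{N}$.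
   Formalization: Added, since the bounds fail otherwise: almost surely the distance (TV and Hellinger) from P^{s+τ(P,ε)}_[s] to Π is at most ε for all ε>0 and s; and, in the Assumption B half, almost surely all subgradients g(x;ξ_t), x∈X, have dual norm at most G. *)

theory Defs
  imports "HOL-Probability.Probability"
begin

definition is_norm :: "('a::real_vector \<Rightarrow> real) \<Rightarrow> bool" where
  "is_norm N \<longleftrightarrow>
     (\<forall>x. N x = 0 \<longleftrightarrow> x = 0) \<and>
     (\<forall>c x. N (c *\<^sub>R x) = \<bar>c\<bar> * N x) \<and>
     (\<forall>x y. N (x + y) \<le> N x + N y)"

definition dual_norm :: "('a::euclidean_space \<Rightarrow> real) \<Rightarrow> 'a \<Rightarrow> real" where
  "dual_norm N z = (SUP x\<in>{x. N x \<le> 1}. z \<bullet> x)"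

text \<open>
  An extended-valued convex function is represented by its effective domain \<open>D\<close> and its (real)
  values on \<open>D\<close>; values of \<open>h\<close> off \<open>D\<close> are irrelevant and stand for \<open>+\<infinity>\<close>. Accordingly, closedness
  is closedness of the epigraph over \<open>D\<close>, and the subgradient inequality is only required on \<open>D\<close>.
\<close>

definition closed_convex_fun :: "'a::euclidean_space set \<Rightarrow> ('a \<Rightarrow> real) \<Rightarrow> bool" where
  "closed_convex_fun D h \<longleftrightarrow> convex_on D h \<and> closed (epigraph D h)"

definition subdifferential :: "'a::euclidean_space set \<Rightarrow> ('a \<Rightarrow> real) \<Rightarrow> 'a \<Rightarrow> 'a set" where
  "subdifferential D h x = {v. x \<in> D \<and> (\<forall>y\<in>D. h y \<ge> h x + v \<bullet> (y - x))}"

definition objective :: "'s measure \<Rightarrow> ('a \<Rightarrow> 's \<Rightarrow> real) \<Rightarrow> 'a \<Rightarrow> real" where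
  "objective \<nu> F x = (\<integral>z. F x z \<partial>\<nu>)"

definition bregman :: "('a::real_inner \<Rightarrow> real) \<Rightarrow> ('a \<Rightarrow> 'a) \<Rightarrow> 'a \<Rightarrow> 'a \<Rightarrow> real" where
  "bregman \<psi> \<psi>' x y = \<psi> x - \<psi> y - \<psi>' y \<bullet> (x - y)"

text \<open>
  The derivative of \<open>\<psi>\<close> is taken within \<open>X\<close>. When \<open>X\<close> has empty interior, \<open>\<psi>' x\<close> is determined only
  up to a vector orthogonal to all \<open>y - x\<close> with \<open>y \<in> X\<close>, which affects neither the Bregman
  divergence on \<open>X\<close> nor strong convexity over \<open>X\<close>.
\<close>

definition prox_function ::
  "('a::euclidean_space \<Rightarrow> real) \<Rightarrow> 'a set \<Rightarrow> ('a \<Rightarrow> real) \<Rightarrow> ('a \<Rightarrow> 'a) \<Rightarrow> bool" where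
  "prox_function N X \<psi> \<psi>' \<longleftrightarrow>
     convex_on X \<psi> \<and>
     (\<forall>x\<in>X. (\<psi> has_derivative (\<lambda>h. \<psi>' x \<bullet> h)) (at x within X)) \<and>
     (\<forall>x\<in>X. \<forall>y\<in>X. \<psi> y \<ge> \<psi> x + \<psi>' x \<bullet> (y - x) + (N (x - y))\<^sup>2 / 2)"

text \<open>The measure \<open>\<nu>\<close> is the target distribution, and its measurable space is the sample space.
  Samples are indexed from 1 on, so \<open>hist M \<nu> \<xi> 0\<close> is the trivial \<open>\<sigma>\<close>-algebra.\<close>

definition hist :: "'w measure \<Rightarrow> 's measure \<Rightarrow> (nat \<Rightarrow> 'w \<Rightarrow> 's) \<Rightarrow> nat \<Rightarrow> 'w measure" where
  "hist M \<nu> \<xi> t = sigma (space M) (\<Union>i\<in>{1..t}. {\<xi> i -` A \<inter> space M | A. A \<in> sets \<nu>})"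

definition emd_iterates ::
  "'w measure \<Rightarrow> 'a::euclidean_space set \<Rightarrow> ('a \<Rightarrow> real) \<Rightarrow> ('a \<Rightarrow> 'a) \<Rightarrow> ('a \<Rightarrow> 's \<Rightarrow> 'a) \<Rightarrow>
   (nat \<Rightarrow> real) \<Rightarrow> (nat \<Rightarrow> 'w \<Rightarrow> 's) \<Rightarrow> 'a \<Rightarrow> (nat \<Rightarrow> 'w \<Rightarrow> 'a) \<Rightarrow> bool" where
  "emd_iterates M X \<psi> \<psi>' sg \<alpha> \<xi> x1 x \<longleftrightarrow>
     (\<forall>\<omega>\<in>space M. x 1 \<omega> = x1 \<and>
        (\<forall>t\<ge>1. is_arg_min
           (\<lambda>y. sg (x t \<omega>) (\<xi> t \<omega>) \<bullet> y + (1 / \<alpha> t) * bregman \<psi> \<psi>' y (x t \<omega>))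
           (\<lambda>y. y \<in> X) (x (Suc t) \<omega>)))"

text \<open>
  \<open>nn_cond_exp\<close> rather than \<open>real_cond_exp\<close>: the latter is 0 by convention for a nonnegative function
  whose conditional expectation is infinite.
\<close>

definition finite_single_step_variance ::
  "'w measure \<Rightarrow> 's measure \<Rightarrow> (nat \<Rightarrow> 'w \<Rightarrow> 's) \<Rightarrow> ('a::euclidean_space \<Rightarrow> real) \<Rightarrow> 'a set \<Rightarrow>
   ('a \<Rightarrow> 's \<Rightarrow> 'a) \<Rightarrow> real \<Rightarrow> bool" where
  "finite_single_step_variance M \<nu> \<xi> N X sg G \<longleftrightarrow>
     (\<forall>t\<ge>1. \<forall>x. x \<in> borel_measurable (hist M \<nu> \<xi> (t - 1)) \<and> (\<forall>\<omega>\<in>space M. x \<omega> \<in> X) \<longrightarrow>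
        (AE \<omega> in M. nn_cond_exp M (hist M \<nu> \<xi> (t - 1))
            (\<lambda>\<omega>. ennreal ((dual_norm N (sg (x \<omega>) (\<xi> t \<omega>)))\<^sup>2)) \<omega> \<le> ennreal (G\<^sup>2)))"

definition lipschitz_over :: "('a::real_vector \<Rightarrow> real) \<Rightarrow> 'a set \<Rightarrow> real \<Rightarrow> ('a \<Rightarrow> real) \<Rightarrow> bool" where
  "lipschitz_over N X G h \<longleftrightarrow> (\<forall>x\<in>X. \<forall>y\<in>X. \<bar>h x - h y\<bar> \<le> G * N (x - y))"

text \<open>
  Lipschitz continuity over \<open>X\<close> for \<open>\<nu>\<close>-almost every sample does not by itself bound the subgradients
  that are actually used: the \<open>\<xi> t\<close> may charge a \<open>\<nu>\<close>-null set, and at boundary points of \<open>X\<close> (or if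
  \<open>X\<close> has empty interior) a subgradient of a function that is \<open>G\<close>-Lipschitz over \<open>X\<close> can have dual
  norm larger than \<open>G\<close>.
\<close>

definition sampled_subgradients_bounded ::
  "'w measure \<Rightarrow> (nat \<Rightarrow> 'w \<Rightarrow> 's) \<Rightarrow> ('a::euclidean_space \<Rightarrow> real) \<Rightarrow> 'a set \<Rightarrow>
   ('a \<Rightarrow> 's \<Rightarrow> 'a) \<Rightarrow> real \<Rightarrow> bool" where
  "sampled_subgradients_bounded M \<xi> N X sg G \<longleftrightarrow>
     (AE \<omega> in M. \<forall>t\<ge>1. \<forall>x\<in>X. dual_norm N (sg x (\<xi> t \<omega>)) \<le> G)"

text \<open>
  The distances are computed from the densities with respect to the dominating measure \<open>Q1 + Q2\<close>;
  \<open>tv_dist_density\<close> and \<open>hel_dist_density\<close> below show that any other choice gives the same value.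
  There is no factor \<open>1/2\<close>, so the largest values are \<open>2\<close> and \<open>sqrt 2\<close>.
\<close>

definition measure_plus :: "'s measure \<Rightarrow> 's measure \<Rightarrow> 's measure" where
  "measure_plus Q1 Q2 =
     measure_of (space Q1) (sets Q1) (\<lambda>A. emeasure Q1 A + emeasure Q2 A)"

definition plus_density :: "'s measure \<Rightarrow> 's measure \<Rightarrow> 's measure \<Rightarrow> 's \<Rightarrow> real" where
  "plus_density Q1 Q2 Q z = enn2real (RN_deriv (measure_plus Q1 Q2) Q z)"

definition tv_dist :: "'s measure \<Rightarrow> 's measure \<Rightarrow> real" where
  "tv_dist Q1 Q2 =
     (\<integral>z. \<bar>plus_density Q1 Q2 Q1 z - plus_density Q1 Q2 Q2 z\<bar> \<partial>measure_plus Q1 Q2)"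

definition hel_dist :: "'s measure \<Rightarrow> 's measure \<Rightarrow> real" where
  "hel_dist Q1 Q2 =
     sqrt (\<integral>z. (sqrt (plus_density Q1 Q2 Q1 z) - sqrt (plus_density Q1 Q2 Q2 z))\<^sup>2
             \<partial>measure_plus Q1 Q2)"

definition conditional_distribution ::
  "'w measure \<Rightarrow> 'w measure \<Rightarrow> ('w \<Rightarrow> 's) \<Rightarrow> 's measure \<Rightarrow> ('w \<Rightarrow> 's measure) \<Rightarrow> bool" where
  "conditional_distribution M H Y S \<kappa> \<longleftrightarrow>
     \<kappa> \<in> measurable H (prob_algebra S) \<and>
     (\<forall>A\<in>sets S. AE \<omega> in M.
        measure (\<kappa> \<omega>) A = real_cond_exp M H (indicator (Y -` A \<inter> space M)) \<omega>)"

text \<open>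
  In the following, \<open>\<kappa> s t \<omega>\<close> is the distribution of \<open>\<xi> t\<close> conditioned on \<open>hist M \<nu> \<xi> s\<close> and \<open>d\<close> is
  \<open>tv_dist\<close> or \<open>hel_dist\<close>. Lags start at 1; the mixing time is \<open>\<infinity>\<close> if no lag qualifies.
\<close>

definition mixing_time ::
  "('s measure \<Rightarrow> 's measure \<Rightarrow> real) \<Rightarrow> 's measure \<Rightarrow> (nat \<Rightarrow> nat \<Rightarrow> 'w \<Rightarrow> 's measure) \<Rightarrow>
   nat \<Rightarrow> real \<Rightarrow> 'w \<Rightarrow> enat" where
  "mixing_time d \<nu> \<kappa> s \<epsilon> \<omega> = Inf {enat t | t. t \<ge> 1 \<and> d (\<kappa> s (s + t) \<omega>) \<nu> \<le> \<epsilon>}"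

definition uniform_mixing_time ::
  "'w measure \<Rightarrow> ('s measure \<Rightarrow> 's measure \<Rightarrow> real) \<Rightarrow> 's measure \<Rightarrow>
   (nat \<Rightarrow> nat \<Rightarrow> 'w \<Rightarrow> 's measure) \<Rightarrow> (real \<Rightarrow> nat) \<Rightarrow> bool" where
  "uniform_mixing_time M d \<nu> \<kappa> \<tau> \<longleftrightarrow>
     (AE \<omega> in M. \<forall>\<epsilon>>0. \<forall>s. mixing_time d \<nu> \<kappa> s \<epsilon> \<omega> \<le> enat (\<tau> \<epsilon>))"

text \<open>
  For a general process the distance to \<open>\<nu>\<close> need not decrease with the lag, so a bound on the first
  lag at which it is at most \<open>\<epsilon>\<close> says nothing about the lag \<open>\<tau> \<epsilon>\<close>. For instance, if \<open>\<xi> t\<close> is an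
  independent draw from \<open>\<nu>\<close> for odd \<open>t\<close> and constant for even \<open>t\<close>, the mixing times are at most 2
  for every \<open>\<epsilon>\<close>. The next condition holds automatically if the distance is non-increasing in the
  lag, e.g. for a time-homogeneous Markov chain with stationary distribution \<open>\<nu>\<close>.
\<close>

definition mixed_at ::
  "'w measure \<Rightarrow> ('s measure \<Rightarrow> 's measure \<Rightarrow> real) \<Rightarrow> 's measure \<Rightarrow>
   (nat \<Rightarrow> nat \<Rightarrow> 'w \<Rightarrow> 's measure) \<Rightarrow> (real \<Rightarrow> nat) \<Rightarrow> bool" where
  "mixed_at M d \<nu> \<kappa> \<tau> \<longleftrightarrow>
     (AE \<omega> in M. \<forall>\<epsilon>>0. \<forall>s. d (\<kappa> s (s + \<tau> \<epsilon>) \<omega>) \<nu> \<le> \<epsilon>)"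

lemma measure_plus_density:
  fixes q1 q2 :: "'s \<Rightarrow> real"
  assumes [measurable]: "q1 \<in> borel_measurable \<mu>" "q2 \<in> borel_measurable \<mu>"
    and nn: "\<And>z. 0 \<le> q1 z" "\<And>z. 0 \<le> q2 z"
  shows "measure_plus (density \<mu> q1) (density \<mu> q2) = density \<mu> (\<lambda>z. ennreal (q1 z + q2 z))"
proof (rule measure_eqI)
  show s: "sets (measure_plus (density \<mu> q1) (density \<mu> q2)) =
      sets (density \<mu> (\<lambda>z. ennreal (q1 z + q2 z)))"
    by (simp add: measure_plus_def)
  fix A assume "A \<in> sets (measure_plus (density \<mu> q1) (density \<mu> q2))"
  then have A[measurable]: "A \<in> sets \<mu>" using s by simp
  have eq: "emeasure (density \<mu> q1) B + emeasure (density \<mu> q2) B =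
      emeasure (density \<mu> (\<lambda>z. ennreal (q1 z + q2 z))) B" if [measurable]: "B \<in> sets \<mu>" for B
    by (simp add: emeasure_density nn ennreal_plus[symmetric] nn_integral_add[symmetric]
        distrib_right[symmetric] del: ennreal_plus)
  have "emeasure (measure_plus (density \<mu> q1) (density \<mu> q2)) A =
      emeasure (density \<mu> q1) A + emeasure (density \<mu> q2) A"
  proof (rule emeasure_measure_of[OF measure_plus_def])
    show "countably_additive (sets (measure_plus (density \<mu> q1) (density \<mu> q2)))
        (\<lambda>A. emeasure (density \<mu> q1) A + emeasure (density \<mu> q2) A)"
      unfolding s countably_additive_def
    proof (intro allI impI)
      fix B :: "nat \<Rightarrow> 's set"
      assume B: "range B \<subseteq> sets (density \<mu> (\<lambda>z. ennreal (q1 z + q2 z)))" "disjoint_family B"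
        "\<Union> (range B) \<in> sets (density \<mu> (\<lambda>z. ennreal (q1 z + q2 z)))"
      have "(\<Sum>i. emeasure (density \<mu> q1) (B i) + emeasure (density \<mu> q2) (B i)) =
          (\<Sum>i. emeasure (density \<mu> (\<lambda>z. ennreal (q1 z + q2 z))) (B i))"
        using B(1) by (intro suminf_cong eq) auto
      also have "\<dots> = emeasure (density \<mu> (\<lambda>z. ennreal (q1 z + q2 z))) (\<Union> (range B))"
        using B by (intro suminf_emeasure) auto
      also have "\<dots> = emeasure (density \<mu> q1) (\<Union> (range B)) + emeasure (density \<mu> q2) (\<Union> (range B))"
        using B(3) by (intro eq[symmetric]) simp
      finally show "(\<Sum>i. emeasure (density \<mu> q1) (B i) + emeasure (density \<mu> q2) (B i)) =
          emeasure (density \<mu> q1) (\<Union> (range B)) + emeasure (density \<mu> q2) (\<Union> (range B))" .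
    qed
  qed (use sets.sets_into_space[of _ \<mu>] s in \<open>auto simp: positive_def\<close>)
  then show "emeasure (measure_plus (density \<mu> q1) (density \<mu> q2)) A =
      emeasure (density \<mu> (\<lambda>z. ennreal (q1 z + q2 z))) A"
    using eq[OF A] by simp
qed

lemma plus_density_density:
  fixes q1 q2 q :: "'s \<Rightarrow> real"
  assumes [measurable]: "q1 \<in> borel_measurable \<mu>" "q2 \<in> borel_measurable \<mu>" "q \<in> borel_measurable \<mu>"
    and nn: "\<And>z. 0 \<le> q1 z" "\<And>z. 0 \<le> q2 z" "\<And>z. 0 \<le> q z" "\<And>z. q z \<le> q1 z + q2 z"
    and "sigma_finite_measure \<mu>"
  shows "AE z in \<mu>. (q1 z + q2 z) * plus_density (density \<mu> q1) (density \<mu> q2) (density \<mu> q) z = q z"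
proof -
  interpret sigma_finite_measure \<mu> by fact
  define \<sigma> where "\<sigma> = density \<mu> (\<lambda>z. ennreal (q1 z + q2 z))"
  have \<sigma>: "measure_plus (density \<mu> q1) (density \<mu> q2) = \<sigma>"
    unfolding \<sigma>_def by (rule measure_plus_density) (use nn in auto)
  have "density \<sigma> (\<lambda>z. ennreal (q z / (q1 z + q2 z))) = density \<mu> q"
    unfolding \<sigma>_def
  proof (subst density_density_eq; (simp; fail)?; intro density_cong AE_I2)
    fix z
    show "ennreal (q1 z + q2 z) * ennreal (q z / (q1 z + q2 z)) = ennreal (q z)"
      using nn[of z] nn(1,2)[of z]
      by (cases "q1 z + q2 z = 0") (auto simp: ennreal_mult[symmetric] simp del: ennreal_plus)
  qed auto
  moreover have "(\<lambda>z. ennreal (q z / (q1 z + q2 z))) \<in> borel_measurable \<sigma>"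
    unfolding \<sigma>_def by simp
  ultimately have "density \<sigma> (RN_deriv \<sigma> (density \<mu> q)) = density \<mu> q"
    by (intro RN_derivI)
  moreover have meas[measurable]: "RN_deriv \<sigma> (density \<mu> q) \<in> borel_measurable \<mu>"
    using borel_measurable_RN_deriv[of \<sigma> "density \<mu> q"]
    by (subst (asm) (2) \<sigma>_def) simp
  ultimately have "density \<mu> (\<lambda>z. ennreal (q1 z + q2 z) * RN_deriv \<sigma> (density \<mu> q) z) = density \<mu> q"
    unfolding \<sigma>_def
    by (subst (asm) density_density_eq) auto
  then have "AE z in \<mu>. ennreal (q1 z + q2 z) * RN_deriv \<sigma> (density \<mu> q) z = ennreal (q z)"
    by (subst density_unique_iff[symmetric])
       auto
  then show ?thesis
  proof eventually_elim
    case (elim z)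
    then show ?case
      unfolding plus_density_def \<sigma>
      using nn[of z] nn(1,2)[of z]
      by (metis add_nonneg_nonneg enn2real_ennreal enn2real_mult)
  qed
qed

lemma sigma_finite_homogeneous_integral:
  fixes q1 q2 :: "'s \<Rightarrow> real" and \<phi> :: "real \<Rightarrow> real \<Rightarrow> real"
  assumes [measurable]: "q1 \<in> borel_measurable \<mu>" "q2 \<in> borel_measurable \<mu>"
    and nn: "\<And>z. 0 \<le> q1 z" "\<And>z. 0 \<le> q2 z"
    and sf: "sigma_finite_measure \<mu>"
    and \<phi>[measurable]: "(\<lambda>(a, b). \<phi> a b) \<in> borel_measurable (borel \<Otimes>\<^sub>M borel)"
    and hom: "\<And>c a b. 0 \<le> c \<Longrightarrow> 0 \<le> a \<Longrightarrow> 0 \<le> b \<Longrightarrow> c * \<phi> a b = \<phi> (c * a) (c * b)"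
  defines "Q1 \<equiv> density \<mu> q1" and "Q2 \<equiv> density \<mu> q2"
  shows "(\<integral>z. \<phi> (plus_density Q1 Q2 Q1 z) (plus_density Q1 Q2 Q2 z) \<partial>measure_plus Q1 Q2) =
    (\<integral>z. \<phi> (q1 z) (q2 z) \<partial>\<mu>)"
proof -
  have \<sigma>: "measure_plus Q1 Q2 = density \<mu> (\<lambda>z. ennreal (q1 z + q2 z))"
    unfolding Q1_def Q2_def by (rule measure_plus_density) (use nn in auto)
  have [measurable]: "plus_density Q1 Q2 Q \<in> borel_measurable \<mu>" for Q
  proof -
    have "plus_density Q1 Q2 Q \<in> borel_measurable (measure_plus Q1 Q2)"
      unfolding plus_density_def by measurable
    then show ?thesis unfolding \<sigma> by simp
  qed
  have p1: "AE z in \<mu>. (q1 z + q2 z) * plus_density Q1 Q2 Q1 z = q1 z"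
    unfolding Q1_def Q2_def by (rule plus_density_density) (use nn sf in auto)
  have p2: "AE z in \<mu>. (q1 z + q2 z) * plus_density Q1 Q2 Q2 z = q2 z"
    unfolding Q1_def Q2_def by (rule plus_density_density) (use nn sf in auto)
  have "(\<integral>z. \<phi> (plus_density Q1 Q2 Q1 z) (plus_density Q1 Q2 Q2 z) \<partial>measure_plus Q1 Q2) =
      (\<integral>z. (q1 z + q2 z) * \<phi> (plus_density Q1 Q2 Q1 z) (plus_density Q1 Q2 Q2 z) \<partial>\<mu>)"
    unfolding \<sigma> by (subst integral_density) (use nn in auto)
  also have "\<dots> = (\<integral>z. \<phi> (q1 z) (q2 z) \<partial>\<mu>)"
  proof (rule integral_cong_AE)
    show "AE z in \<mu>. (q1 z + q2 z) * \<phi> (plus_density Q1 Q2 Q1 z) (plus_density Q1 Q2 Q2 z) =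
        \<phi> (q1 z) (q2 z)"
      using p1 p2
    proof eventually_elim
      case (elim z)
      then show ?case
        by (subst hom) (use nn[of z] in \<open>auto simp: plus_density_def\<close>)
    qed
  qed auto
  finally show ?thesis .
qed

lemma tv_dist_density:
  fixes q1 q2 :: "'s \<Rightarrow> real"
  assumes "q1 \<in> borel_measurable \<mu>" "q2 \<in> borel_measurable \<mu>"
    and "\<And>z. 0 \<le> q1 z" "\<And>z. 0 \<le> q2 z" and "sigma_finite_measure \<mu>"
  shows "tv_dist (density \<mu> q1) (density \<mu> q2) = (\<integral>z. \<bar>q1 z - q2 z\<bar> \<partial>\<mu>)"
  unfolding tv_dist_def
  by (rule sigma_finite_homogeneous_integral[where \<phi> = "\<lambda>a b. \<bar>a - b\<bar>"])
     (use assms in \<open>auto simp: abs_mult right_diff_distrib[symmetric]\<close>)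

lemma hel_dist_density:
  fixes q1 q2 :: "'s \<Rightarrow> real"
  assumes "q1 \<in> borel_measurable \<mu>" "q2 \<in> borel_measurable \<mu>"
    and "\<And>z. 0 \<le> q1 z" "\<And>z. 0 \<le> q2 z" and "sigma_finite_measure \<mu>"
  shows "(hel_dist (density \<mu> q1) (density \<mu> q2))\<^sup>2 = (\<integral>z. (sqrt (q1 z) - sqrt (q2 z))\<^sup>2 \<partial>\<mu>)"
proof -
  have "(\<integral>z. (sqrt (plus_density (density \<mu> q1) (density \<mu> q2) (density \<mu> q1) z) -
            sqrt (plus_density (density \<mu> q1) (density \<mu> q2) (density \<mu> q2) z))\<^sup>2
          \<partial>measure_plus (density \<mu> q1) (density \<mu> q2)) = (\<integral>z. (sqrt (q1 z) - sqrt (q2 z))\<^sup>2 \<partial>\<mu>)"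
    by (rule sigma_finite_homogeneous_integral[where \<phi> = "\<lambda>a b. (sqrt a - sqrt b)\<^sup>2"])
       (use assms in \<open>auto simp: real_sqrt_mult right_diff_distrib[symmetric] power_mult_distrib\<close>)
  then show ?thesis
    unfolding hel_dist_def by (simp add: integral_nonneg_AE)
qed

end

theory Submission
  imports Defs
begin

text \<open>
  Split the regret at time \<open>t\<close> by comparing \<open>x t\<close> with the sample \<open>\<xi> u\<close>, \<open>u = t + \<tau> - 1\<close>. Given the history
  before \<open>t\<close>, \<open>\<xi> u\<close> is \<open>\<epsilon>\<close>-close to the target, so the expectations of \<open>F (x t) - F xstar\<close> under the two
  differ by \<open>\<epsilon> G R\<close> (total variation) or \<open>3 \<epsilon> G R\<close> (Hellinger). Replacing \<open>x t\<close> by \<open>x u\<close> costs the drift of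
  the iterates over \<open>\<tau> - 1\<close> steps, each of length at most \<open>\<alpha> s\<close> times the dual norm of the subgradient,
  and what remains is the regret of mirror descent on the sampled functions. The last \<open>\<tau> - 1\<close> terms
  are bounded by \<open>G R\<close> each.
\<close>

section \<open>Norms and their duals\<close>

text \<open>The lag is counted from \<open>t - 1\<close>: the iterate \<open>x t\<close> depends on
  \<open>\<xi> 1\<close>, ..., \<open>\<xi> (t - 1)\<close> only, and a lag of \<open>\<tau>\<close>
  from there ends at \<open>t + \<tau> - 1\<close>. Hence the penalty \<open>\<tau> - 1\<close>,
  which vanishes for mixing time 1. The two bounds share everything but the comparison of
  \<open>\<xi> u\<close> with the target, which enters as an error \<open>\<delta>\<close> per step;
  Assumption A and the almost sure bound on the sampled subgradients both enter through a
  second-moment bound in expectation. Products of dual norms at different times are therefore split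
  by AM-GM into second moments of single times. Measurability is the main obstacle. The iterates are
  specified only as minimizers, so uniqueness of the prox step has to make them adapted; joint
  measurability is assumed of \<open>sg\<close> alone, while \<open>F\<close> has to be evaluated at
  random points. The Hellinger comparison is applied to a random conditional law, whose second
  moments are controlled only on average over \<open>\<omega>\<close>. The best constant of that
  argument is \<open>2 * sqrt 2\<close>, rounded up to 3.\<close>

context
  fixes N :: "'a::euclidean_space \<Rightarrow> real"
  assumes N: "is_norm N"
begin

lemma is_norm_zero [simp]: "N 0 = 0"
  using N by (simp add: is_norm_def)

lemma is_norm_minus [simp]: "N (- x) = N x"
proof -
  have "N ((-1) *\<^sub>R x) = \<bar>-1\<bar> * N x"
    using N unfolding is_norm_def by blast
  then show ?thesis by simp
qed

lemma is_norm_commute: "N (x - y) = N (y - x)"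
  by (metis is_norm_minus minus_diff_eq)

lemma is_norm_triangle: "N (x + y) \<le> N x + N y"
  using N by (simp add: is_norm_def)

lemma is_norm_scaleR: "N (c *\<^sub>R x) = \<bar>c\<bar> * N x"
  using N by (simp add: is_norm_def)

lemma is_norm_nonneg: "0 \<le> N x"
  using is_norm_triangle[of x "- x"] by simp

lemma is_norm_pos: "x \<noteq> 0 \<Longrightarrow> 0 < N x"
  using N is_norm_nonneg[of x] by (auto simp: is_norm_def less_le)

text \<open>The triangle inequality and homogeneity make \<open>N\<close> convex, and a finite
  convex function on a Euclidean space is continuous.\<close>

lemma is_norm_continuous_on: "continuous_on S N"
proof -
  have "convex_on UNIV N"
    unfolding convex_on_def
    by (auto intro!: order_trans[OF is_norm_triangle] simp: is_norm_scaleR)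
  then show ?thesis
    using convex_on_continuous[of UNIV N] continuous_on_subset by blast
qed

text \<open>By compactness \<open>N\<close> attains a positive minimum on the Euclidean unit sphere,
  and homogeneity spreads this bound. This half of the equivalence of norms keeps the supremum in
  \<open>dual_norm\<close> finite.\<close>

lemma is_norm_ge_norm: obtains c where "0 < c" "\<And>x. norm x \<le> c * N x"
proof -
  obtain b :: 'a where "norm b = 1"
    using vector_choose_size[of 1] by auto
  then have "sphere (0::'a) 1 \<noteq> {}" by (auto intro!: exI[of _ b])
  then obtain m where m: "norm m = 1" "\<And>x. norm x = 1 \<Longrightarrow> N m \<le> N x"
    using continuous_attains_inf[OF compact_sphere _ is_norm_continuous_on, of 0 1]
    by auto
  have m0: "0 < N m" using m(1) by (intro is_norm_pos) auto
  have "norm x \<le> (1 / N m) * N x" for x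
  proof (cases "x = 0")
    case False
    then have "N m \<le> N ((1 / norm x) *\<^sub>R x)" by (intro m) auto
    then show ?thesis using False m0 by (auto simp: is_norm_scaleR field_simps)
  qed auto
  with m0 show ?thesis by (intro that[of "1 / N m"]) auto
qed

lemma dual_norm_bdd: "bdd_above ((\<lambda>x. z \<bullet> x) ` {x. N x \<le> 1})"
proof -
  obtain c where c: "0 < c" "\<And>x. norm x \<le> c * N x" using is_norm_ge_norm by blast
  have "z \<bullet> x \<le> norm z * c" if "N x \<le> 1" for x
  proof -
    have "norm x \<le> c" using c(2)[of x] mult_left_mono[OF that, of c] c(1) by linarith
    then have "norm z * norm x \<le> norm z * c" by (intro mult_left_mono) auto
    then show ?thesis using norm_cauchy_schwarz[of z x] by linarith
  qed
  then show ?thesis by (intro bdd_aboveI2) auto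
qed

lemma dual_norm_upper: "N x \<le> 1 \<Longrightarrow> z \<bullet> x \<le> dual_norm N z"
  unfolding dual_norm_def by (rule cSUP_upper[OF _ dual_norm_bdd]) auto

lemma dual_norm_least: "(\<And>x. N x \<le> 1 \<Longrightarrow> z \<bullet> x \<le> c) \<Longrightarrow> dual_norm N z \<le> c"
  unfolding dual_norm_def by (rule cSUP_least) (auto intro!: exI[of _ 0])

lemma dual_norm_nonneg: "0 \<le> dual_norm N z"
  using dual_norm_upper[of 0 z] by simp

lemma inner_le_dual_norm: "z \<bullet> x \<le> dual_norm N z * N x"
proof (cases "x = 0")
  case False
  then have "z \<bullet> ((1 / N x) *\<^sub>R x) \<le> dual_norm N z"
    using is_norm_pos[of x] by (intro dual_norm_upper) (auto simp: is_norm_scaleR)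
  then show ?thesis using is_norm_pos[OF False] by (auto simp: field_simps)
qed auto

lemma dual_norm_continuous_on: "continuous_on S (dual_norm N)"
proof -
  have "convex_on UNIV (dual_norm N)"
    unfolding convex_on_def
  proof (intro conjI ballI allI impI)
    fix x y :: 'a and u v :: real assume uv: "0 \<le> u" "0 \<le> v" "u + v = 1"
    show "dual_norm N (u *\<^sub>R x + v *\<^sub>R y) \<le> u * dual_norm N x + v * dual_norm N y"
      using uv by (intro dual_norm_least)
        (auto simp: inner_add_left intro!: add_mono mult_left_mono dual_norm_upper)
  qed auto
  then show ?thesis
    using convex_on_continuous[of UNIV "dual_norm N"] continuous_on_subset by blast
qed

lemma dual_norm_measurable [measurable]: "dual_norm N \<in> borel_measurable borel"
  by (intro borel_measurable_continuous_onI dual_norm_continuous_on)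

end

section \<open>The prox step\<close>

text \<open>The derivative of \<open>\<psi>\<close> exists only within \<open>X\<close>, so the
  quotients run along the segment from \<open>x\<close> to \<open>y\<close>, which convexity keeps
  in \<open>X\<close>. The sequential form serves twice: for the optimality condition of the prox
  step and for the measurability of the Bregman divergence.\<close>

lemma directional_derivative_within:
  fixes \<psi> :: "'a::euclidean_space \<Rightarrow> real"
  assumes d: "(\<psi> has_derivative (\<lambda>h. v \<bullet> h)) (at x within X)" and "convex X" "x \<in> X" "y \<in> X"
  shows "(\<lambda>n. real (Suc n) * (\<psi> (x + (1 / real (Suc n)) *\<^sub>R (y - x)) - \<psi> x)) \<longlonglongrightarrow> v \<bullet> (y - x)"
proof -
  define l where "l s = x + s *\<^sub>R (y - x)" for s :: real
  have lX: "l s \<in> X" if "s \<in> {0..1}" for s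
  proof -
    have "l s = (1 - s) *\<^sub>R x + s *\<^sub>R y" by (simp add: l_def algebra_simps)
    then show ?thesis using that convexD_alt[OF \<open>convex X\<close> \<open>x \<in> X\<close> \<open>y \<in> X\<close>, of s] by auto
  qed
  have dl: "(l has_derivative (\<lambda>s. s *\<^sub>R (y - x))) (at 0 within {0..1})"
    unfolding l_def by (auto intro!: derivative_eq_intros)
  have "(\<psi> has_derivative (\<lambda>h. v \<bullet> h)) (at (l 0) within l ` {0..1})"
    using has_derivative_subset[OF d, of "l ` {0..1}"] lX by (force simp: l_def[of 0])
  from diff_chain_within[OF dl this]
  have "((\<lambda>s. \<psi> (l s)) has_derivative (\<lambda>s. (v \<bullet> (y - x)) * s)) (at 0 within {0..1})"
    by (simp add: o_def mult.commute)
  then have "((\<lambda>s. \<psi> (l s)) has_field_derivative (v \<bullet> (y - x))) (at 0 within {0..1})"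
    by (simp add: has_field_derivative_def)
  then have lim: "((\<lambda>s. (\<psi> (l s) - \<psi> (l 0)) / (s - 0)) \<longlongrightarrow> v \<bullet> (y - x)) (at 0 within {0..1})"
    by (simp add: has_field_derivative_iff)
  have "filterlim (\<lambda>n. 1 / real (Suc n)) (at 0 within {0..1}) sequentially"
    unfolding filterlim_at
  proof
    show "(\<lambda>n. 1 / real (Suc n)) \<longlonglongrightarrow> 0"
      by (rule LIMSEQ_inverse_real_of_nat[unfolded inverse_eq_divide])
  qed (auto intro!: always_eventually simp: divide_simps)
  from filterlim_compose[OF lim this] show ?thesis
    by (simp add: l_def mult.commute)
qed

lemma prox_functionD:
  assumes "prox_function N X \<psi> \<psi>'" "x \<in> X" "y \<in> X"
  shows "(\<psi> has_derivative (\<lambda>h. \<psi>' x \<bullet> h)) (at x within X)"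
    and "(N (y - x))\<^sup>2 / 2 \<le> bregman \<psi> \<psi>' x y"
  using assms unfolding prox_function_def bregman_def by (force simp: inner_diff_right)+

lemma prox_function_continuous_on: "prox_function N X \<psi> \<psi>' \<Longrightarrow> continuous_on X \<psi>"
  by (auto simp: continuous_on_eq_continuous_within prox_function_def
      dest!: bspec dest: has_derivative_continuous)

text \<open>Minimality at \<open>x'\<close> against the points of the segment towards
  \<open>y\<close>, divided by the step length, gives the first-order condition in the limit. The
  identity D(y,x) - D(x',x) - D(y,x') = (\<psi>'(x') - \<psi>'(x)) \<bullet> (y - x') turns it into
  the claim.\<close>

lemma three_point_inequality:
  fixes \<psi> :: "'a::euclidean_space \<Rightarrow> real"
  assumes prox: "prox_function N X \<psi> \<psi>'" and "convex X" "0 < a" "y \<in> X"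
    and am: "is_arg_min (\<lambda>y. g \<bullet> y + (1 / a) * bregman \<psi> \<psi>' y x) (\<lambda>y. y \<in> X) x'"
  shows "g \<bullet> x' + (1 / a) * bregman \<psi> \<psi>' x' x + (1 / a) * bregman \<psi> \<psi>' y x'
      \<le> g \<bullet> y + (1 / a) * bregman \<psi> \<psi>' y x"
proof -
  have x': "x' \<in> X" and min: "\<And>y. y \<in> X \<Longrightarrow> g \<bullet> x' + (1 / a) * bregman \<psi> \<psi>' x' x
      \<le> g \<bullet> y + (1 / a) * bregman \<psi> \<psi>' y x"
    using am by (auto simp: is_arg_min_linorder)
  have "0 \<le> g \<bullet> (y - x') + (1 / a) * (\<psi>' x' \<bullet> (y - x') - \<psi>' x \<bullet> (y - x'))"
  proof (rule LIMSEQ_le_const)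
    show "(\<lambda>n. g \<bullet> (y - x') + (1 / a) *
        (real (Suc n) * (\<psi> (x' + (1 / real (Suc n)) *\<^sub>R (y - x')) - \<psi> x') - \<psi>' x \<bullet> (y - x')))
      \<longlonglongrightarrow> g \<bullet> (y - x') + (1 / a) * (\<psi>' x' \<bullet> (y - x') - \<psi>' x \<bullet> (y - x'))"
      by (intro tendsto_intros directional_derivative_within[of _ _ _ X] prox_functionD(1)[OF prox])
         (use x' assms in auto)
    show "\<exists>M. \<forall>n\<ge>M. 0 \<le> g \<bullet> (y - x') + (1 / a) *
        (real (Suc n) * (\<psi> (x' + (1 / real (Suc n)) *\<^sub>R (y - x')) - \<psi> x') - \<psi>' x \<bullet> (y - x'))"
    proof (intro exI allI impI)
      fix n :: nat
      define s where "s = 1 / real (Suc n)"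
      have s: "0 < s" "s \<le> 1" by (auto simp: s_def divide_simps)
      define z where "z = x' + s *\<^sub>R (y - x')"
      have "z = (1 - s) *\<^sub>R x' + s *\<^sub>R y" by (simp add: z_def algebra_simps)
      then have "z \<in> X" using s convexD_alt[OF \<open>convex X\<close> x' \<open>y \<in> X\<close>, of s] by auto
      from min[OF this]
      have "0 \<le> s * (g \<bullet> (y - x')) + (1 / a) * (\<psi> z - \<psi> x' - s * (\<psi>' x \<bullet> (y - x')))"
        unfolding bregman_def z_def by (simp add: algebra_simps inner_simps)
      also have "\<dots> = s * (g \<bullet> (y - x') + (1 / a) * ((1 / s) * (\<psi> z - \<psi> x') - \<psi>' x \<bullet> (y - x')))"
        using s \<open>0 < a\<close> by (simp add: field_simps)
      finally show "0 \<le> g \<bullet> (y - x') + (1 / a) *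
        (real (Suc n) * (\<psi> (x' + (1 / real (Suc n)) *\<^sub>R (y - x')) - \<psi> x') - \<psi>' x \<bullet> (y - x'))"
        using s(1) by (simp only: zero_le_mult_iff z_def) (auto simp: s_def)
    qed
  qed
  then show ?thesis
    unfolding bregman_def by (simp add: algebra_simps inner_simps)
qed

context
  fixes N :: "'a::euclidean_space \<Rightarrow> real" and X \<psi> \<psi>' a g x x'
  assumes N: "is_norm N" and prox: "prox_function N X \<psi> \<psi>'" and "convex X" "0 < a"
    and "x \<in> X"
    and am: "is_arg_min (\<lambda>y. g \<bullet> y + (1 / a) * bregman \<psi> \<psi>' y x) (\<lambda>y. y \<in> X) x'"
begin

lemma prox_step_in: "x' \<in> X"
  using am by (auto simp: is_arg_min_linorder)

text \<open>A second minimizer \<open>y\<close> would force D(y,x') \<le> 0 by the three-point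
  inequality, while strong convexity makes this divergence positive. Uniqueness is what makes the
  iterates measurable.\<close>

lemma prox_step_unique:
  assumes "y \<in> X" "g \<bullet> y + (1 / a) * bregman \<psi> \<psi>' y x \<le> g \<bullet> x' + (1 / a) * bregman \<psi> \<psi>' x' x"
  shows "y = x'"
proof (rule ccontr)
  assume "y \<noteq> x'"
  then have "0 < N (x' - y)" by (intro is_norm_pos[OF N]) auto
  then have "0 < (N (x' - y))\<^sup>2 / 2" by simp
  also have "\<dots> \<le> bregman \<psi> \<psi>' y x'"
    using prox_functionD(2)[OF prox \<open>y \<in> X\<close> prox_step_in] .
  finally have "0 < (1 / a) * bregman \<psi> \<psi>' y x'" using \<open>0 < a\<close> by simp
  then show False
    using three_point_inequality[OF prox \<open>convex X\<close> \<open>0 < a\<close> \<open>y \<in> X\<close> am] assms(2) by linarith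
qed

text \<open>The three-point inequality at \<open>y = x\<close> bounds D(x',x) + D(x,x') by
  \<open>a * (g \<bullet> (x - x'))\<close>. Strong convexity bounds each divergence below by half
  the squared length, and one factor of the length cancels.\<close>

lemma prox_step_length: "N (x' - x) \<le> a * dual_norm N g"
proof -
  have "(N (x' - x))\<^sup>2 / 2 \<le> bregman \<psi> \<psi>' x x'" "(N (x' - x))\<^sup>2 / 2 \<le> bregman \<psi> \<psi>' x' x"
    using prox_functionD(2)[OF prox \<open>x \<in> X\<close> prox_step_in]
      prox_functionD(2)[OF prox prox_step_in \<open>x \<in> X\<close>] is_norm_commute[OF N, of x x'] by auto
  moreover have "bregman \<psi> \<psi>' x' x + bregman \<psi> \<psi>' x x' \<le> a * (g \<bullet> (x - x'))"
    using three_point_inequality[OF prox \<open>convex X\<close> \<open>0 < a\<close> \<open>x \<in> X\<close> am] \<open>0 < a\<close>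
    by (simp add: bregman_def[of \<psi> \<psi>' x x] field_simps inner_simps)
  moreover have "a * (g \<bullet> (x - x')) \<le> a * (dual_norm N g * N (x' - x))"
    using inner_le_dual_norm[OF N, of g "x - x'"] \<open>0 < a\<close> is_norm_commute[OF N, of x x']
    by (intro mult_left_mono) auto
  ultimately have *: "N (x' - x) * N (x' - x) \<le> (a * dual_norm N g) * N (x' - x)"
    by (simp add: power2_eq_square mult.assoc)
  show ?thesis
  proof (cases "N (x' - x) = 0")
    case True
    then show ?thesis using \<open>0 < a\<close> dual_norm_nonneg[OF N, of g] by simp
  next
    case False
    then have "0 < N (x' - x)" using is_norm_nonneg[OF N, of "x' - x"] by simp
    with * show ?thesis by (rule mult_right_le_imp_le)
  qed
qed

text \<open>The three-point inequality handles \<open>g \<bullet> (x' - y)\<close>. The remaining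
  \<open>g \<bullet> (x - x')\<close> is split by AM-GM with the weight for which its quadratic part
  is absorbed by D(x',x).\<close>

lemma prox_step_regret:
  assumes "y \<in> X"
  shows "g \<bullet> (x - y) \<le> (1 / a) * (bregman \<psi> \<psi>' y x - bregman \<psi> \<psi>' y x') + a / 2 * (dual_norm N g)\<^sup>2"
proof -
  have "g \<bullet> (x - x') \<le> dual_norm N g * N (x' - x)"
    using inner_le_dual_norm[OF N, of g "x - x'"] is_norm_commute[OF N, of x x'] by simp
  also have "\<dots> \<le> a / 2 * (dual_norm N g)\<^sup>2 + (1 / a) * ((N (x' - x))\<^sup>2 / 2)"
  proof -
    have "0 \<le> (a * dual_norm N g - N (x' - x))\<^sup>2 / (2 * a)" using \<open>0 < a\<close> by simp
    also have "\<dots> = a / 2 * (dual_norm N g)\<^sup>2 + (1 / a) * ((N (x' - x))\<^sup>2 / 2) - dual_norm N g * N (x' - x)"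
      using \<open>0 < a\<close> by (simp add: power2_eq_square field_simps)
    finally show ?thesis by simp
  qed
  also have "(1 / a) * ((N (x' - x))\<^sup>2 / 2) \<le> (1 / a) * bregman \<psi> \<psi>' x' x"
    using prox_functionD(2)[OF prox prox_step_in \<open>x \<in> X\<close>] \<open>0 < a\<close> is_norm_commute[OF N, of x x']
    by (intro mult_left_mono) auto
  finally show ?thesis
    using three_point_inequality[OF prox \<open>convex X\<close> \<open>0 < a\<close> \<open>y \<in> X\<close> am]
    by (simp add: algebra_simps inner_simps)
qed

end

text \<open>The minimizer lies in a closed set \<open>C\<close> iff the infima over \<open>C \<inter> X\<close> and over \<open>X\<close> agree, and
  countable dense subsets suffice to compare these.\<close>

lemma borel_measurable_unique_minimizer:
  fixes J :: "'a::euclidean_space \<Rightarrow> 'w \<Rightarrow> real"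
  assumes X: "compact X"
    and J: "\<And>y. y \<in> X \<Longrightarrow> J y \<in> borel_measurable H"
    and cont: "\<And>\<omega>. \<omega> \<in> space H \<Longrightarrow> continuous_on X (\<lambda>y. J y \<omega>)"
    and m: "\<And>\<omega>. \<omega> \<in> space H \<Longrightarrow> m \<omega> \<in> X"
    and min: "\<And>\<omega> y. \<omega> \<in> space H \<Longrightarrow> y \<in> X \<Longrightarrow> J (m \<omega>) \<omega> \<le> J y \<omega>"
    and uniq: "\<And>\<omega> y. \<omega> \<in> space H \<Longrightarrow> y \<in> X \<Longrightarrow> J y \<omega> \<le> J (m \<omega>) \<omega> \<Longrightarrow> y = m \<omega>"
  shows "m \<in> borel_measurable H"
proof (subst borel_eq_closed, rule measurable_measure_of)
  fix C :: "'a set" assume "C \<in> Collect closed"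
  then have "closed C" by simp
  obtain E where E: "countable E" "E \<subseteq> X" "X \<subseteq> closure E" using separable[of X] by auto
  obtain E' where E': "countable E'" "E' \<subseteq> C \<inter> X" "C \<inter> X \<subseteq> closure E'"
    using separable[of "C \<inter> X"] by auto
  have dense: "\<exists>c\<in>B. J c \<omega> < J y \<omega> + e"
    if w: "\<omega> \<in> space H" and y: "y \<in> X" "y \<in> closure B" and B: "B \<subseteq> X" and e: "0 < e" for \<omega> y B and e :: real
  proof -
    obtain d where "0 < d" and d: "\<And>z. z \<in> X \<Longrightarrow> dist z y < d \<Longrightarrow> dist (J z \<omega>) (J y \<omega>) < e"
      using cont[OF w] y(1) e unfolding continuous_on_iff by metis
    then obtain c where "c \<in> B" "dist c y < d" using y(2) unfolding closure_approachable by blast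
    with d[of c] B show ?thesis by (intro bexI[of _ c]) (auto simp: dist_real_def abs_less_iff)
  qed
  have "m -` C \<inter> space H =
      {\<omega>\<in>space H. \<forall>d\<in>E. \<forall>n::nat. \<exists>c\<in>E'. J c \<omega> < J d \<omega> + 1 / real (Suc n)}" (is "?L = ?R")
  proof (intro set_eqI iffI)
    fix \<omega> assume w: "\<omega> \<in> ?L"
    then have wH: "\<omega> \<in> space H" and "m \<omega> \<in> C \<inter> X" using m by auto
    then have "m \<omega> \<in> closure E'" using E' by auto
    have "\<exists>c\<in>E'. J c \<omega> < J d \<omega> + 1 / real (Suc n)" if "d \<in> E" for d n
    proof -
      have "\<exists>c\<in>E'. J c \<omega> < J (m \<omega>) \<omega> + 1 / real (Suc n)"
        using wH \<open>m \<omega> \<in> closure E'\<close> E' m by (intro dense) auto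
      moreover have "J (m \<omega>) \<omega> \<le> J d \<omega>" using min wH that E by auto
      ultimately show ?thesis by force
    qed
    with wH show "\<omega> \<in> ?R" by auto
  next
    fix \<omega> assume w: "\<omega> \<in> ?R"
    then have wH: "\<omega> \<in> space H" by auto
    have key: "\<exists>c\<in>C \<inter> X. J c \<omega> < J (m \<omega>) \<omega> + e" if e: "0 < e" for e
    proof -
      obtain n where n: "1 / real (Suc n) < e / 2"
        using reals_Archimedean[of "e/2"] half_gt_zero[OF e] unfolding inverse_eq_divide by blast
      have "\<exists>d\<in>E. J d \<omega> < J (m \<omega>) \<omega> + e / 2"
        using wH E m e by (intro dense) auto
      then obtain d where d: "d \<in> E" "J d \<omega> < J (m \<omega>) \<omega> + e / 2" by blast
      with w obtain c where c: "c \<in> E'" "J c \<omega> < J d \<omega> + 1 / real (Suc n)" by blast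
      have "J c \<omega> < J (m \<omega>) \<omega> + e" using c d n by linarith
      with c E' show ?thesis by blast
    qed
    \<comment> \<open>Compactness makes the infimum over \<open>C \<inter> X\<close> a minimum,
      attained at \<open>c0\<close>; it ties with the value at \<open>m \<omega>\<close>, so
      uniqueness identifies the two points and places \<open>m \<omega>\<close> in
      \<open>C\<close>.\<close>
    have "C \<inter> X \<noteq> {}" using key[of 1] by auto
    moreover have "compact (C \<inter> X)" using \<open>closed C\<close> X by auto
    moreover have "continuous_on (C \<inter> X) (\<lambda>y. J y \<omega>)"
      using cont[OF wH] by (rule continuous_on_subset) auto
    ultimately obtain c0 where c0: "c0 \<in> C \<inter> X" "\<And>c. c \<in> C \<inter> X \<Longrightarrow> J c0 \<omega> \<le> J c \<omega>"
      using continuous_attains_inf[of "C \<inter> X"] by blast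
    have "J c0 \<omega> \<le> J (m \<omega>) \<omega>"
    proof (rule field_le_epsilon)
      fix e :: real assume "0 < e"
      from key[OF this] c0 show "J c0 \<omega> \<le> J (m \<omega>) \<omega> + e" by force
    qed
    then have "c0 = m \<omega>" using uniq[OF wH] c0 by auto
    then show "\<omega> \<in> ?L" using c0 wH by auto
  qed
  also have "\<dots> \<in> sets H"
  proof -
    have *: "{\<omega>\<in>space H. J c \<omega> < J d \<omega> + 1 / real (Suc n)} \<in> sets H" if "c \<in> E'" "d \<in> E" for c d and n :: nat
      using J[of c] J[of d] that E(2) E'(2)
      by (intro borel_measurable_less borel_measurable_add) auto
    show ?thesis
      by (intro sets.sets_Collect_countable_All' sets.sets_Collect_countable_All
          sets.sets_Collect_countable_Ex' *) (use E E' in auto)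
  qed
  finally show "m -` C \<inter> space H \<in> sets H" .
qed auto

text \<open>The gradient \<open>\<psi>'\<close> itself need not be measurable when \<open>X\<close> has empty interior; its products with
  feasible directions are limits of difference quotients of \<open>\<psi>\<close>.\<close>

lemma bregman_measurable_right:
  fixes \<psi> :: "'a::euclidean_space \<Rightarrow> real"
  assumes prox: "prox_function N X \<psi> \<psi>'" and X: "compact X" "convex X" and y: "y \<in> X"
    and [measurable]: "u \<in> borel_measurable H" and u: "\<And>\<omega>. \<omega> \<in> space H \<Longrightarrow> u \<omega> \<in> X"
  shows "(\<lambda>\<omega>. bregman \<psi> \<psi>' y (u \<omega>)) \<in> borel_measurable H"
proof -
  have *: "(\<lambda>\<omega>. \<psi> (v \<omega>)) \<in> borel_measurable H"
    if [measurable]: "v \<in> borel_measurable H" and v: "\<And>\<omega>. \<omega> \<in> space H \<Longrightarrow> v \<omega> \<in> X" for v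
  proof -
    have "v \<in> measurable H (restrict_space borel X)"
      using v by (auto simp: measurable_restrict_space2_iff)
    moreover have "\<psi> \<in> borel_measurable (restrict_space borel X)"
      by (rule borel_measurable_continuous_on_restrict) (rule prox_function_continuous_on[OF prox])
    ultimately show ?thesis by (rule measurable_compose)
  qed
  have "(\<lambda>\<omega>. \<psi>' (u \<omega>) \<bullet> (y - u \<omega>)) \<in> borel_measurable H"
  proof (rule borel_measurable_LIMSEQ_real)
    fix \<omega> assume "\<omega> \<in> space H"
    then show "(\<lambda>n. real (Suc n) * (\<psi> (u \<omega> + (1 / real (Suc n)) *\<^sub>R (y - u \<omega>)) - \<psi> (u \<omega>)))
        \<longlonglongrightarrow> \<psi>' (u \<omega>) \<bullet> (y - u \<omega>)"
      using prox_functionD(1)[OF prox] X y u by (intro directional_derivative_within[of _ _ _ X]) auto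
  next
    fix n :: nat
    have "u \<omega> + (1 / real (Suc n)) *\<^sub>R (y - u \<omega>) \<in> X" if "\<omega> \<in> space H" for \<omega>
    proof -
      have "u \<omega> + (1 / real (Suc n)) *\<^sub>R (y - u \<omega>) =
          (1 - 1 / real (Suc n)) *\<^sub>R u \<omega> + (1 / real (Suc n)) *\<^sub>R y"
        by (simp add: algebra_simps)
      then show ?thesis using convexD_alt[OF X(2) u[OF that] y, of "1 / real (Suc n)"] by auto
    qed
    then show "(\<lambda>\<omega>. real (Suc n) * (\<psi> (u \<omega> + (1 / real (Suc n)) *\<^sub>R (y - u \<omega>)) - \<psi> (u \<omega>)))
        \<in> borel_measurable H"
      using u by (intro borel_measurable_times borel_measurable_diff *) auto
  qed
  then show ?thesis
    unfolding bregman_def using u y by (intro borel_measurable_diff *) auto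
qed

text \<open>The next iterate is known only pointwise as a minimizer; a set of several minimizers
  could be selected from in a non-measurable way, so strong convexity enters through
  \<open>prox_step_unique\<close>.\<close>

lemma prox_step_measurable:
  fixes \<psi> :: "'a::euclidean_space \<Rightarrow> real"
  assumes N: "is_norm N" and prox: "prox_function N X \<psi> \<psi>'" and X: "compact X" "convex X" and a: "0 < a"
    and [measurable]: "u \<in> borel_measurable H" "g \<in> borel_measurable H"
    and u: "\<And>\<omega>. \<omega> \<in> space H \<Longrightarrow> u \<omega> \<in> X"
    and am: "\<And>\<omega>. \<omega> \<in> space H \<Longrightarrow>
      is_arg_min (\<lambda>y. g \<omega> \<bullet> y + (1 / a) * bregman \<psi> \<psi>' y (u \<omega>)) (\<lambda>y. y \<in> X) (u' \<omega>)"
  shows "u' \<in> borel_measurable H"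
proof (rule borel_measurable_unique_minimizer[OF X(1),
      where J = "\<lambda>y \<omega>. g \<omega> \<bullet> y + (1 / a) * bregman \<psi> \<psi>' y (u \<omega>)"])
  show "(\<lambda>\<omega>. g \<omega> \<bullet> y + (1 / a) * bregman \<psi> \<psi>' y (u \<omega>)) \<in> borel_measurable H" if "y \<in> X" for y
    using bregman_measurable_right[OF prox X that _ u] by measurable
  show "continuous_on X (\<lambda>y. g \<omega> \<bullet> y + (1 / a) * bregman \<psi> \<psi>' y (u \<omega>))" for \<omega>
    unfolding bregman_def by (intro continuous_intros prox_function_continuous_on[OF prox])
  show "y = u' \<omega>" if "\<omega> \<in> space H" "y \<in> X"
    "g \<omega> \<bullet> y + (1 / a) * bregman \<psi> \<psi>' y (u \<omega>) \<le> g \<omega> \<bullet> u' \<omega> + (1 / a) * bregman \<psi> \<psi>' (u' \<omega>) (u \<omega>)"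
    for \<omega> y
    using prox_step_unique[OF N prox X(2) a u[OF that(1)] am[OF that(1)]] that by auto
qed (use am in \<open>auto simp: is_arg_min_linorder\<close>)

section \<open>Increments of a convex function as limits of Riemann sums of subgradients\<close>

text \<open>Only \<open>sg\<close> is assumed to be jointly measurable; this representation passes joint measurability on
  to the increments of \<open>F\<close>.\<close>

lemma subgradient_riemann_sum:
  fixes h :: "'a::euclidean_space \<Rightarrow> real"
  assumes X: "convex X" "X \<subseteq> D" and v: "\<And>y. y \<in> X \<Longrightarrow> v y \<in> subdifferential D h y"
    and xy: "x \<in> X" "y \<in> X"
  shows "(\<lambda>n. \<Sum>k<Suc n. (1 / real (Suc n)) * (v (x + (real k / real (Suc n)) *\<^sub>R (y - x)) \<bullet> (y - x)))
    \<longlonglongrightarrow> h y - h x"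
proof -
  define p where "p s = x + s *\<^sub>R (y - x)" for s :: real
  define q where "q s = v (p s) \<bullet> (y - x)" for s
  have pX: "p s \<in> X" if "0 \<le> s" "s \<le> 1" for s
  proof -
    have "p s = (1 - s) *\<^sub>R x + s *\<^sub>R y" by (simp add: p_def algebra_simps)
    then show ?thesis using that convexD_alt[OF X(1) xy, of s] by auto
  qed
  have sub: "h (p s') - h (p s) \<ge> (s' - s) * q s" if "0 \<le> s" "s \<le> 1" "0 \<le> s'" "s' \<le> 1" for s s'
  proof -
    have "h (p s') \<ge> h (p s) + v (p s) \<bullet> (p s' - p s)"
      using v[OF pX[OF that(1,2)]] pX[OF that(3,4)] X(2) by (auto simp: subdifferential_def)
    moreover have "p s' - p s = (s' - s) *\<^sub>R (y - x)" by (simp add: p_def algebra_simps)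
    ultimately show ?thesis by (simp add: q_def)
  qed
  define S where "S n = (\<Sum>k<Suc n. (1 / real (Suc n)) * q (real k / real (Suc n)))" for n
  have le: "S n \<le> h y - h x" for n
  proof -
    have "S n \<le> (\<Sum>k<Suc n. h (p (real (Suc k) / real (Suc n))) - h (p (real k / real (Suc n))))"
      unfolding S_def
    proof (rule sum_mono)
      fix k assume "k \<in> {..<Suc n}"
      then show "1 / real (Suc n) * q (real k / real (Suc n))
          \<le> h (p (real (Suc k) / real (Suc n))) - h (p (real k / real (Suc n)))"
        using sub[of "real k / real (Suc n)" "real (Suc k) / real (Suc n)"]
        by (simp add: diff_divide_distrib[symmetric] divide_le_eq)
    qed
    also have "\<dots> = h (p 1) - h (p 0)"
      by (subst sum_lessThan_telescope) simp
    finally show ?thesis by (simp add: p_def)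
  qed
  \<comment> \<open>Sums over left end points lie below the increment and sums over right end points
    above it. The two differ by the telescoping quantity \<open>(q 1 - q 0) / real (Suc n)\<close>,
    which tends to 0.\<close>
  have ge: "h y - h x - (1 / real (Suc n)) * (q 1 - q 0) \<le> S n" for n
  proof -
    have "h (p 1) - h (p 0) =
        (\<Sum>k<Suc n. h (p (real (Suc k) / real (Suc n))) - h (p (real k / real (Suc n))))"
      by (subst sum_lessThan_telescope) simp
    also have "\<dots> \<le> (\<Sum>k<Suc n. (1 / real (Suc n)) * q (real (Suc k) / real (Suc n)))"
    proof (rule sum_mono)
      fix k assume "k \<in> {..<Suc n}"
      then show "h (p (real (Suc k) / real (Suc n))) - h (p (real k / real (Suc n)))
          \<le> 1 / real (Suc n) * q (real (Suc k) / real (Suc n))"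
        using sub[of "real (Suc k) / real (Suc n)" "real k / real (Suc n)"]
        by (simp add: diff_divide_distrib[symmetric] divide_le_eq)
    qed
    also have "\<dots> = S n + (1 / real (Suc n)) * (q 1 - q 0)"
    proof -
      have "(\<Sum>k<Suc n. (1 / real (Suc n)) * q (real (Suc k) / real (Suc n))) - S n =
          (\<Sum>k<Suc n. (1 / real (Suc n)) * q (real (Suc k) / real (Suc n)) -
            (1 / real (Suc n)) * q (real k / real (Suc n)))"
        unfolding S_def by (rule sum_subtractf[symmetric])
      also have "\<dots> = (1 / real (Suc n)) * (q 1 - q 0)"
        by (subst sum_lessThan_telescope) (simp add: right_diff_distrib)
      finally show ?thesis by simp
    qed
    finally show ?thesis by (simp add: p_def)
  qed
  have "S \<longlonglongrightarrow> h y - h x"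
  proof (rule tendsto_sandwich[OF always_eventually always_eventually])
    have "(\<lambda>n. h y - h x - (1 / real (Suc n)) * (q 1 - q 0)) \<longlonglongrightarrow> h y - h x - 0 * (q 1 - q 0)"
      by (intro tendsto_intros LIMSEQ_inverse_real_of_nat[unfolded inverse_eq_divide])
    then show "(\<lambda>n. h y - h x - (1 / real (Suc n)) * (q 1 - q 0)) \<longlonglongrightarrow> h y - h x" by simp
    show "(\<lambda>n. h y - h x) \<longlonglongrightarrow> h y - h x" by simp
  qed (use le ge in auto)
  then show ?thesis by (simp only: S_def[abs_def] q_def p_def)
qed

lemma subgradient_increment_measurable:
  fixes F :: "'a::euclidean_space \<Rightarrow> 's \<Rightarrow> real"
  assumes X: "convex X" "\<And>z. z \<in> space S \<Longrightarrow> X \<subseteq> Dom z"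
    and sg: "\<And>y z. y \<in> X \<Longrightarrow> z \<in> space S \<Longrightarrow> sg y z \<in> subdifferential (Dom z) (\<lambda>y. F y z) y"
    and [measurable]: "(\<lambda>(y, z). sg y z) \<in> borel_measurable (restrict_space borel X \<Otimes>\<^sub>M S)"
    and c: "c \<in> X"
  shows "(\<lambda>(y, z). F y z - F c z) \<in> borel_measurable (restrict_space borel X \<Otimes>\<^sub>M S)"
proof (rule borel_measurable_LIMSEQ_real)
  fix p assume "p \<in> space (restrict_space borel X \<Otimes>\<^sub>M S)"
  then obtain y z where p: "p = (y, z)" "y \<in> X" "z \<in> space S"
    by (auto simp: space_pair_measure space_restrict_space)
  then show "(\<lambda>n. case p of (y, z) \<Rightarrow> \<Sum>k<Suc n. (1 / real (Suc n)) *
      (sg (c + (real k / real (Suc n)) *\<^sub>R (y - c)) z \<bullet> (y - c))) \<longlonglongrightarrow> (case p of (y, z) \<Rightarrow> F y z - F c z)"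
    using subgradient_riemann_sum[OF X(1) X(2)[of z], of "\<lambda>y. sg y z" "\<lambda>y. F y z" c y] sg c by simp
next
  fix n :: nat
  let ?B = "restrict_space borel X :: 'a measure"
  have s: "(\<lambda>p. sg (c + (real k / real (Suc n)) *\<^sub>R (fst p - c)) (snd p)) \<in> borel_measurable (?B \<Otimes>\<^sub>M S)"
    if "k < Suc n" for k
  proof -
    have f: "(\<lambda>p. fst p) \<in> borel_measurable (?B \<Otimes>\<^sub>M S)"
      using measurable_fst[of ?B S] by (auto simp: measurable_restrict_space2_iff)
    have "c + (real k / real (Suc n)) *\<^sub>R (y - c) \<in> X" if "y \<in> X" for y
    proof -
      have "c + (real k / real (Suc n)) *\<^sub>R (y - c) =
          (1 - real k / real (Suc n)) *\<^sub>R c + (real k / real (Suc n)) *\<^sub>R y"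
        by (simp add: algebra_simps)
      then show ?thesis using convexD_alt[OF X(1) c that, of "real k / real (Suc n)"] \<open>k < Suc n\<close> by auto
    qed
    then have "(\<lambda>p. (c + (real k / real (Suc n)) *\<^sub>R (fst p - c), snd p)) \<in> measurable (?B \<Otimes>\<^sub>M S) (?B \<Otimes>\<^sub>M S)"
      using f by (intro measurable_Pair measurable_restrict_space2 measurable_snd borel_measurable_add
          borel_measurable_scaleR borel_measurable_diff)
        (auto simp: space_pair_measure space_restrict_space)
    from measurable_compose[OF this assms(4)] show ?thesis by simp
  qed
  have f: "(\<lambda>p. fst p) \<in> borel_measurable (?B \<Otimes>\<^sub>M S)"
    using measurable_fst[of ?B S] by (auto simp: measurable_restrict_space2_iff)
  show "(\<lambda>p. case p of (y, z) \<Rightarrow> \<Sum>k<Suc n. (1 / real (Suc n)) *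
      (sg (c + (real k / real (Suc n)) *\<^sub>R (y - c)) z \<bullet> (y - c))) \<in> borel_measurable (?B \<Otimes>\<^sub>M S)"
    unfolding case_prod_beta using s f
    by (intro borel_measurable_sum borel_measurable_times borel_measurable_inner borel_measurable_diff) auto
qed

section \<open>Comparing expectations by total variation and Hellinger distance\<close>

lemma emeasure_measure_plus:
  assumes s: "sets Q = sets P" and A: "A \<in> sets P"
  shows "emeasure (measure_plus P Q) A = emeasure P A + emeasure Q A"
proof (rule emeasure_measure_of[OF measure_plus_def])
  have sp: "sets (measure_plus P Q) = sets P"
    by (simp add: measure_plus_def)
  show "countably_additive (sets (measure_plus P Q)) (\<lambda>A. emeasure P A + emeasure Q A)"
    unfolding sp countably_additive_def
  proof (intro allI impI)
    fix B :: "nat \<Rightarrow> 'a set"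
    assume B: "range B \<subseteq> sets P" "disjoint_family B" "\<Union> (range B) \<in> sets P"
    then have "(\<Sum>i. emeasure P (B i) + emeasure Q (B i)) =
        (\<Sum>i. emeasure P (B i)) + (\<Sum>i. emeasure Q (B i))"
      by (intro suminf_add[symmetric]) auto
    also have "\<dots> = emeasure P (\<Union> (range B)) + emeasure Q (\<Union> (range B))"
      using B s by (intro arg_cong2[where f = "(+)"] suminf_emeasure) auto
    finally show "(\<Sum>i. emeasure P (B i) + emeasure Q (B i)) =
        emeasure P (\<Union> (range B)) + emeasure Q (\<Union> (range B))" .
  qed
  show "A \<in> sets (measure_plus P Q)" using A sp by simp
qed (use sets.sets_into_space[of _ P] in \<open>auto simp: positive_def\<close>)

text \<open>Both comparison lemmas see the distances through this form: real densities with respect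
  to one finite measure. \<open>RN_deriv\<close> takes extended values, but is finite almost
  everywhere here, so \<open>enn2real\<close> alters it on a null set only.\<close>

lemma plus_densities:
  fixes P Q :: "'s measure"
  assumes P: "prob_space P" and Q: "prob_space Q" and s: "sets Q = sets P"
  obtains \<sigma> :: "'s measure" and p q :: "'s \<Rightarrow> real"
  where "sets \<sigma> = sets P" "p \<in> borel_measurable \<sigma>" "q \<in> borel_measurable \<sigma>"
    "\<forall>z. 0 \<le> p z" "\<forall>z. 0 \<le> q z" "P = density \<sigma> p" "Q = density \<sigma> q"
    "integrable \<sigma> p" "integrable \<sigma> q"
    "tv_dist P Q = (\<integral>z. \<bar>p z - q z\<bar> \<partial>\<sigma>)"
    "hel_dist P Q = sqrt (\<integral>z. (sqrt (p z) - sqrt (q z))\<^sup>2 \<partial>\<sigma>)"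
proof -
  interpret P: prob_space P by fact
  interpret Q: prob_space Q by fact
  define \<sigma> where "\<sigma> = measure_plus P Q"
  have sig: "sets \<sigma> = sets P" "space \<sigma> = space P" by (simp_all add: \<sigma>_def measure_plus_def)
  have em: "emeasure \<sigma> A = emeasure P A + emeasure Q A" if "A \<in> sets P" for A
    unfolding \<sigma>_def using s that by (rule emeasure_measure_plus)
  have fin: "finite_measure \<sigma>"
    by (rule finite_measureI) (use sig em[of "space P"] sets_eq_imp_space_eq[OF s] in
      \<open>auto simp: P.emeasure_space_1 Q.emeasure_space_1[unfolded sets_eq_imp_space_eq[OF s]]\<close>)
  interpret sigma: finite_measure \<sigma> by fact
  have dens: "density \<sigma> (\<lambda>z. ennreal (plus_density P Q R z)) = R"
    "plus_density P Q R \<in> borel_measurable \<sigma>" "integrable \<sigma> (plus_density P Q R)"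
    if R: "R = P \<or> R = Q" for R
  proof -
    have sR: "sets R = sets \<sigma>" using R s sig by auto
    have pR: "prob_space R" using R P Q by auto
    have ac: "absolutely_continuous \<sigma> R"
      unfolding absolutely_continuous_def using R em sig s
      by (auto simp: null_sets_def)
    have "AE z in \<sigma>. RN_deriv \<sigma> R z \<noteq> \<infinity>"
      using pR by (intro sigma.RN_deriv_finite ac sR prob_space_imp_sigma_finite)
    then have "density \<sigma> (\<lambda>z. ennreal (plus_density P Q R z)) = density \<sigma> (RN_deriv \<sigma> R)"
      unfolding plus_density_def \<sigma>_def[symmetric]
      by (intro density_cong) (auto elim!: eventually_mono simp: top.not_eq_extremum)
    also have "\<dots> = R" by (rule sigma.density_RN_deriv[OF ac sR])
    finally show d: "density \<sigma> (\<lambda>z. ennreal (plus_density P Q R z)) = R" .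
    show m[measurable]: "plus_density P Q R \<in> borel_measurable \<sigma>"
      unfolding plus_density_def \<sigma>_def[symmetric] by measurable
    have "(\<integral>\<^sup>+z. ennreal (plus_density P Q R z) \<partial>\<sigma>) = emeasure R (space \<sigma>)"
      by (subst (2) d[symmetric]) (simp add: emeasure_density cong: nn_integral_cong)
    also have "\<dots> = 1"
      using prob_space.emeasure_space_1[OF pR] sets_eq_imp_space_eq[OF sR] by simp
    finally show "integrable \<sigma> (plus_density P Q R)"
      by (intro integrableI_nonneg) (auto simp: plus_density_def)
  qed
  show thesis
    by (rule that[OF sig(1), of "plus_density P Q P" "plus_density P Q Q"])
      (use dens in \<open>auto simp: plus_density_def tv_dist_def hel_dist_def \<sigma>_def\<close>)
qed

lemma expectation_diff_le_tv_dist: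
  fixes h :: "'s \<Rightarrow> real"
  assumes P: "prob_space P" and Q: "prob_space Q" and s: "sets Q = sets P"
    and h[measurable]: "h \<in> borel_measurable P" and B: "\<And>z. \<bar>h z\<bar> \<le> B"
  shows "(\<integral>z. h z \<partial>Q) - (\<integral>z. h z \<partial>P) \<le> B * tv_dist P Q"
proof -
  obtain \<sigma> p q where *: "sets \<sigma> = sets P" "p \<in> borel_measurable \<sigma>" "q \<in> borel_measurable \<sigma>"
    "\<forall>z. 0 \<le> p z" "\<forall>z. 0 \<le> q z" "P = density \<sigma> p" "Q = density \<sigma> q"
    "integrable \<sigma> p" "integrable \<sigma> q" "tv_dist P Q = (\<integral>z. \<bar>p z - q z\<bar> \<partial>\<sigma>)"
    "hel_dist P Q = sqrt (\<integral>z. (sqrt (p z) - sqrt (q z))\<^sup>2 \<partial>\<sigma>)"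
    by (rule plus_densities[OF P Q s])
  note [measurable] = *(2,3)
  note nn = *(4)[rule_format] *(5)[rule_format]
  have hs[measurable]: "h \<in> borel_measurable \<sigma>" using h *(1) measurable_cong_sets by blast
  have int: "integrable \<sigma> (\<lambda>z. f z * h z)" if [measurable]: "integrable \<sigma> f" "\<And>z. 0 \<le> f z" for f
    using that(2) by (intro Bochner_Integration.integrable_bound[OF integrable_mult_left[OF that(1), of B]])
      (auto simp: abs_mult intro!: mult_left_mono order_trans[OF B])
  have "(\<integral>z. h z \<partial>Q) - (\<integral>z. h z \<partial>P) = (\<integral>z. q z * h z \<partial>\<sigma>) - (\<integral>z. p z * h z \<partial>\<sigma>)"
    unfolding *(6,7) using nn by (simp add: integral_real_density)
  also have "\<dots> = (\<integral>z. q z * h z - p z * h z \<partial>\<sigma>)"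
    using * int by simp
  also have "\<dots> \<le> (\<integral>z. B * \<bar>p z - q z\<bar> \<partial>\<sigma>)"
  proof (rule integral_mono)
    fix z
    have "q z * h z - p z * h z \<le> \<bar>h z\<bar> * \<bar>p z - q z\<bar>"
      by (simp add: abs_mult[symmetric] left_diff_distrib[symmetric])
        (metis abs_ge_self abs_minus_commute abs_mult mult.commute)
    also have "\<dots> \<le> B * \<bar>p z - q z\<bar>" by (intro mult_right_mono B) auto
    finally show "q z * h z - p z * h z \<le> B * \<bar>p z - q z\<bar>" .
  qed (use * int in auto)
  finally show ?thesis using *(10) by simp
qed

text \<open>The free parameter \<open>k\<close> replaces Cauchy-Schwarz by AM-GM: the right-hand side stays affine in the
  second moments, so it can be averaged over a random \<open>P\<close> before \<open>k\<close> is chosen.\<close>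

lemma expectation_diff_le_hel_dist:
  fixes h :: "'s \<Rightarrow> real"
  assumes P: "prob_space P" and Q: "prob_space Q" and s: "sets Q = sets P"
    and h[measurable]: "h \<in> borel_measurable P"
    and hP: "integrable P (\<lambda>z. (h z)\<^sup>2)" and hQ: "integrable Q (\<lambda>z. (h z)\<^sup>2)"
    and e: "hel_dist P Q \<le> \<epsilon>" "0 < \<epsilon>" and k: "0 < k"
  shows "(\<integral>z. h z \<partial>Q) - (\<integral>z. h z \<partial>P) \<le> \<epsilon> * (k / 2 + ((\<integral>z. (h z)\<^sup>2 \<partial>P) + (\<integral>z. (h z)\<^sup>2 \<partial>Q)) / k)"
proof -
  obtain \<sigma> p q where *: "sets \<sigma> = sets P" "p \<in> borel_measurable \<sigma>" "q \<in> borel_measurable \<sigma>"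
    "\<forall>z. 0 \<le> p z" "\<forall>z. 0 \<le> q z" "P = density \<sigma> p" "Q = density \<sigma> q"
    "integrable \<sigma> p" "integrable \<sigma> q" "tv_dist P Q = (\<integral>z. \<bar>p z - q z\<bar> \<partial>\<sigma>)"
    "hel_dist P Q = sqrt (\<integral>z. (sqrt (p z) - sqrt (q z))\<^sup>2 \<partial>\<sigma>)"
    by (rule plus_densities[OF P Q s])
  note [measurable] = *(2,3)
  note nn = *(4)[rule_format] *(5)[rule_format]
  interpret P: prob_space P by fact
  interpret Q: prob_space Q by fact
  have hs[measurable]: "h \<in> borel_measurable \<sigma>" using h *(1) measurable_cong_sets by blast
  have hQm: "h \<in> borel_measurable Q" using h s measurable_cong_sets by blast
  have i2: "integrable \<sigma> (\<lambda>z. p z * (h z)\<^sup>2)" "integrable \<sigma> (\<lambda>z. q z * (h z)\<^sup>2)"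
    using hP hQ unfolding *(6,7) using nn by (simp_all add: integrable_real_density)
  have i1: "integrable \<sigma> (\<lambda>z. p z * h z)" "integrable \<sigma> (\<lambda>z. q z * h z)"
    using P.square_integrable_imp_integrable[OF h hP] Q.square_integrable_imp_integrable[OF hQm hQ]
    unfolding *(6,7) using nn by (simp_all add: integrable_real_density)
  have ih: "integrable \<sigma> (\<lambda>z. (sqrt (p z) - sqrt (q z))\<^sup>2)"
  proof (rule Bochner_Integration.integrable_bound)
    show "integrable \<sigma> (\<lambda>z. p z + q z)" using * by auto
    have "(sqrt (p z) - sqrt (q z))\<^sup>2 \<le> p z + q z" for z
      using nn[of z] by (simp add: power2_diff)
    then show "AE z in \<sigma>. norm ((sqrt (p z) - sqrt (q z))\<^sup>2) \<le> norm (p z + q z)"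
      using nn by (auto intro: order_trans)
  qed auto
  have he: "(\<integral>z. (sqrt (p z) - sqrt (q z))\<^sup>2 \<partial>\<sigma>) \<le> \<epsilon>\<^sup>2"
    using e unfolding *(11) by (simp add: real_le_lsqrt sqrt_le_D)
  have "(\<integral>z. h z \<partial>Q) - (\<integral>z. h z \<partial>P) = (\<integral>z. q z * h z \<partial>\<sigma>) - (\<integral>z. p z * h z \<partial>\<sigma>)"
    unfolding *(6,7) using nn by (simp add: integral_real_density)
  also have "\<dots> = (\<integral>z. q z * h z - p z * h z \<partial>\<sigma>)"
    using i1 by simp
  also have "\<dots> \<le> (\<integral>z. (k / \<epsilon> / 2) * (sqrt (p z) - sqrt (q z))\<^sup>2 + (\<epsilon> / k) * (p z * (h z)\<^sup>2 + q z * (h z)\<^sup>2) \<partial>\<sigma>)"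
  proof (rule integral_mono)
    fix z
    define u v where "u = sqrt (p z)" and "v = sqrt (q z)"
    have pq: "p z = u\<^sup>2" "q z = v\<^sup>2" using nn[of z] by (auto simp: u_def v_def)
    \<comment> \<open>AM-GM for v^2 - u^2 = (v - u)(u + v), followed by (u + v)^2 \<le> 2(u^2 +
      v^2), whose defect is the second square. The weight \<open>k / \<epsilon>\<close> makes both
      resulting terms of order \<open>\<epsilon>\<close> once the squared Hellinger distance is
      bounded by \<epsilon>^2.\<close>
    have "0 \<le> ((k / \<epsilon>) * (v - u) - (u + v) * h z)\<^sup>2 + (u - v)\<^sup>2 * (h z)\<^sup>2" by simp
    then have "0 \<le> (((k / \<epsilon>) * (v - u) - (u + v) * h z)\<^sup>2 + (u - v)\<^sup>2 * (h z)\<^sup>2) * (\<epsilon> / (2 * k))"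
      using e k by (intro mult_nonneg_nonneg) auto
    also have "\<dots> = (k / \<epsilon> / 2) * (u - v)\<^sup>2 + (\<epsilon> / k) * (u\<^sup>2 * (h z)\<^sup>2 + v\<^sup>2 * (h z)\<^sup>2) - (v\<^sup>2 * h z - u\<^sup>2 * h z)"
      using e k by (simp add: field_simps power2_eq_square)
    finally show "q z * h z - p z * h z \<le>
        (k / \<epsilon> / 2) * (sqrt (p z) - sqrt (q z))\<^sup>2 + (\<epsilon> / k) * (p z * (h z)\<^sup>2 + q z * (h z)\<^sup>2)"
      unfolding pq by (simp add: u_def v_def nn)
  qed (use i1 i2 ih in auto)
  also have "\<dots> = (k / \<epsilon> / 2) * (\<integral>z. (sqrt (p z) - sqrt (q z))\<^sup>2 \<partial>\<sigma>)
      + (\<epsilon> / k) * ((\<integral>z. p z * (h z)\<^sup>2 \<partial>\<sigma>) + (\<integral>z. q z * (h z)\<^sup>2 \<partial>\<sigma>))"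
    using i2 ih by simp
  also have "\<dots> \<le> (k / \<epsilon> / 2) * \<epsilon>\<^sup>2 + (\<epsilon> / k) * ((\<integral>z. p z * (h z)\<^sup>2 \<partial>\<sigma>) + (\<integral>z. q z * (h z)\<^sup>2 \<partial>\<sigma>))"
    using e k by (intro add_mono mult_left_mono he) auto
  also have "\<dots> = \<epsilon> * (k / 2 + ((\<integral>z. (h z)\<^sup>2 \<partial>P) + (\<integral>z. (h z)\<^sup>2 \<partial>Q)) / k)"
    unfolding *(6,7) using nn e k
    by (simp add: integral_real_density power2_eq_square field_simps)
  finally show ?thesis .
qed

section \<open>Disintegration\<close>

lemma conditional_distributionD:
  assumes "conditional_distribution M H Y S \<kappa>"
  shows "\<kappa> \<in> measurable H (prob_algebra S)" "\<kappa> \<in> measurable H (subprob_algebra S)"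
    "\<And>\<omega>. \<omega> \<in> space H \<Longrightarrow> prob_space (\<kappa> \<omega>)" "\<And>\<omega>. \<omega> \<in> space H \<Longrightarrow> sets (\<kappa> \<omega>) = sets S"
    "\<And>A. A \<in> sets S \<Longrightarrow> AE \<omega> in M. measure (\<kappa> \<omega>) A = real_cond_exp M H (indicator (Y -` A \<inter> space M)) \<omega>"
proof -
  show k: "\<kappa> \<in> measurable H (prob_algebra S)"
    using assms by (simp add: conditional_distribution_def)
  then show "\<kappa> \<in> measurable H (subprob_algebra S)"
    by (rule measurable_prob_algebraD)
  show "prob_space (\<kappa> \<omega>)" "sets (\<kappa> \<omega>) = sets S" if "\<omega> \<in> space H" for \<omega>
    using measurable_space[OF k that] by (auto simp: space_prob_algebra)
  show "\<And>A. A \<in> sets S \<Longrightarrow> AE \<omega> in M. measure (\<kappa> \<omega>) A = real_cond_exp M H (indicator (Y -` A \<inter> space M)) \<omega>"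
    using assms by (simp add: conditional_distribution_def)
qed

text \<open>\<open>conditional_distribution\<close> speaks of one event at a time, each with its own
  null set, whereas \<open>\<phi>\<close> also depends on the history. The joint law of history and
  sample (\<open>J1\<close>) and the law built from the kernel (\<open>J2\<close>) agree on
  rectangles by the defining property of the conditional expectation. Rectangles form an
  intersection-stable generator, hence the laws are equal.\<close>

lemma nn_integral_disintegration:
  assumes M: "prob_space M" and sub: "subalgebra M H" and Y[measurable]: "Y \<in> measurable M S"
    and \<kappa>: "conditional_distribution M H Y S \<kappa>"
    and \<phi>: "\<phi> \<in> borel_measurable (H \<Otimes>\<^sub>M S)"
  shows "(\<integral>\<^sup>+\<omega>. \<integral>\<^sup>+z. \<phi> (\<omega>, z) \<partial>\<kappa> \<omega> \<partial>M) = (\<integral>\<^sup>+\<omega>. \<phi> (\<omega>, Y \<omega>) \<partial>M)"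
proof -
  interpret prob_space M by fact
  interpret finite_measure_subalgebra M H
    using sub by unfold_locales
  note kD = conditional_distributionD[OF \<kappa>]
  note [measurable] = kD(2)
  have spH: "space H = space M" using sub by (simp add: subalgebra_def)
  have idH[measurable]: "(\<lambda>\<omega>. \<omega>) \<in> measurable M H"
    using sub by (auto intro!: measurable_from_subalg[OF sub])
  define J1 where "J1 = distr M (H \<Otimes>\<^sub>M S) (\<lambda>\<omega>. (\<omega>, Y \<omega>))"
  define K where "K = (\<lambda>\<omega>. distr (\<kappa> \<omega>) (H \<Otimes>\<^sub>M S) (Pair \<omega>))"
  \<comment> \<open>The kernel is measurable with respect to \<open>H\<close> only, so it is bound
    to the restriction of \<open>M\<close> to \<open>H\<close>.\<close>
  define M' where "M' = restr_to_subalg M H"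
  have sM': "sets M' = sets H" and spM': "space M' = space M"
    by (auto simp: M'_def sets_restr_to_subalg[OF sub] space_restr_to_subalg)
  have K: "K \<in> measurable H (subprob_algebra (H \<Otimes>\<^sub>M S))"
    unfolding K_def by (rule measurable_distr2[OF _ kD(2)]) measurable
  then have K': "K \<in> measurable M' (subprob_algebra (H \<Otimes>\<^sub>M S))"
    using sM' measurable_cong_sets by blast
  define J2 where "J2 = M' \<bind> K"
  have neM': "space M' \<noteq> {}" using not_empty spM' by simp
  have J2: "(\<integral>\<^sup>+x. f x \<partial>J2) = (\<integral>\<^sup>+\<omega>. \<integral>\<^sup>+z. f (\<omega>, z) \<partial>\<kappa> \<omega> \<partial>M)"
    if f[measurable]: "f \<in> borel_measurable (H \<Otimes>\<^sub>M S)" for f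
  proof -
    have "(\<integral>\<^sup>+x. f x \<partial>J2) = (\<integral>\<^sup>+\<omega>. \<integral>\<^sup>+x. f x \<partial>K \<omega> \<partial>M')"
      unfolding J2_def by (rule nn_integral_bind[OF f K'])
    also have "\<dots> = (\<integral>\<^sup>+\<omega>. \<integral>\<^sup>+z. f (\<omega>, z) \<partial>\<kappa> \<omega> \<partial>M')"
    proof (rule nn_integral_cong)
      fix \<omega> assume "\<omega> \<in> space M'"
      then have w: "\<omega> \<in> space H" using spH spM' by simp
      have "Pair \<omega> \<in> measurable (\<kappa> \<omega>) (H \<Otimes>\<^sub>M S)"
        unfolding measurable_cong_sets[OF kD(4)[OF w] refl] using w by measurable
      then show "(\<integral>\<^sup>+x. f x \<partial>K \<omega>) = (\<integral>\<^sup>+z. f (\<omega>, z) \<partial>\<kappa> \<omega>)"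
        unfolding K_def by (simp add: nn_integral_distr)
    qed
    also have "\<dots> = (\<integral>\<^sup>+\<omega>. \<integral>\<^sup>+z. f (\<omega>, z) \<partial>\<kappa> \<omega> \<partial>M)"
      unfolding M'_def
      by (intro nn_integral_subalgebra2[OF sub] nn_integral_measurable_subprob_algebra2[OF _ kD(2)])
        (simp add: case_prod_eta)
    finally show ?thesis .
  qed
  have "J1 = J2"
  proof (rule measure_eqI_generator_eq[where A = "\<lambda>_. space H \<times> space S",
        OF Int_stable_pair_measure_generator[of H S] pair_measure_closed])
    show "sets J1 = sigma_sets (space H \<times> space S) {a \<times> b |a b. a \<in> sets H \<and> b \<in> sets S}"
      by (simp add: J1_def sets_pair_measure)
    show "sets J2 = sigma_sets (space H \<times> space S) {a \<times> b |a b. a \<in> sets H \<and> b \<in> sets S}"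
      unfolding J2_def by (subst sets_bind[OF sets_kernel[OF K'] neM']) (simp_all add: sets_pair_measure)
    show "emeasure J1 (space H \<times> space S) \<noteq> \<infinity>"
      unfolding J1_def by (subst emeasure_distr) auto
    fix C assume "C \<in> {a \<times> b |a b. a \<in> sets H \<and> b \<in> sets S}"
    then obtain B A where C: "C = B \<times> A" and B[measurable]: "B \<in> sets H" and A[measurable]: "A \<in> sets S"
      by auto
    have B': "B \<in> sets M" using B sub by (auto simp: subalgebra_def)
    have BM: "(\<lambda>\<omega>. indicator B \<omega> :: real) \<in> borel_measurable H" by measurable
    have YA: "Y -` A \<inter> space M \<in> sets M" by measurable
    have int: "integrable M (\<lambda>\<omega>. indicator B \<omega> * indicator (Y -` A \<inter> space M) \<omega> :: real)"
      using B' YA by (simp add: indicator_inter_arith[symmetric] integrable_indicator_iff less_top[symmetric])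
    have "emeasure J2 C = (\<integral>\<^sup>+x. indicator C x \<partial>J2)"
      using C by (subst nn_integral_indicator)
        (auto simp: J2_def sets_bind[OF sets_kernel[OF K'] neM'])
    also have "\<dots> = (\<integral>\<^sup>+\<omega>. \<integral>\<^sup>+z. indicator C (\<omega>, z) \<partial>\<kappa> \<omega> \<partial>M)"
      using C by (intro J2) auto
    also have "\<dots> = (\<integral>\<^sup>+\<omega>. ennreal (indicator B \<omega> * measure (\<kappa> \<omega>) A) \<partial>M)"
    proof (rule nn_integral_cong)
      fix \<omega> assume "\<omega> \<in> space M"
      then have w: "\<omega> \<in> space H" using spH by simp
      interpret k: prob_space "\<kappa> \<omega>" using kD(3)[OF w] .
      have "(\<integral>\<^sup>+z. indicator C (\<omega>, z) \<partial>\<kappa> \<omega>) = (\<integral>\<^sup>+z. indicator B \<omega> * indicator A z \<partial>\<kappa> \<omega>)"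
        by (intro nn_integral_cong) (auto simp: C indicator_def)
      also have "\<dots> = indicator B \<omega> * emeasure (\<kappa> \<omega>) A"
        using A kD(4)[OF w] by (intro nn_integral_cmult_indicator) simp
      finally show "(\<integral>\<^sup>+z. indicator C (\<omega>, z) \<partial>\<kappa> \<omega>) = ennreal (indicator B \<omega> * measure (\<kappa> \<omega>) A)"
        by (simp add: k.emeasure_eq_measure ennreal_mult ennreal_indicator)
    qed
    also have "\<dots> = (\<integral>\<^sup>+\<omega>. ennreal (indicator B \<omega> * real_cond_exp M H (indicator (Y -` A \<inter> space M)) \<omega>) \<partial>M)"
      by (rule nn_integral_cong_AE) (use kD(5)[OF A] in \<open>auto elim: eventually_mono\<close>)
    also have "\<dots> = ennreal (\<integral>\<omega>. indicator B \<omega> * real_cond_exp M H (indicator (Y -` A \<inter> space M)) \<omega> \<partial>M)"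
    proof (rule nn_integral_eq_integral)
      show "integrable M (\<lambda>\<omega>. indicator B \<omega> * real_cond_exp M H (indicator (Y -` A \<inter> space M)) \<omega>)"
        using real_cond_exp_intg(1)[OF int BM] YA by simp
      show "AE \<omega> in M. 0 \<le> indicator B \<omega> * real_cond_exp M H (indicator (Y -` A \<inter> space M)) \<omega>"
        using kD(5)[OF A]
      proof eventually_elim
        case (elim \<omega>)
        then show ?case using measure_nonneg[of "\<kappa> \<omega>" A] by simp
      qed
    qed
    also have "\<dots> = ennreal (\<integral>\<omega>. indicator B \<omega> * indicator (Y -` A \<inter> space M) \<omega> \<partial>M)"
      using real_cond_exp_intg(2)[OF int BM] YA by simp
    also have "\<dots> = emeasure M (B \<inter> (Y -` A \<inter> space M))"
    proof -
      have "B \<inter> (Y -` A \<inter> space M) \<inter> space M = B \<inter> (Y -` A \<inter> space M)" by auto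
      then show ?thesis by (simp add: indicator_inter_arith[symmetric] emeasure_eq_measure)
    qed
    also have "\<dots> = emeasure J1 C"
      unfolding J1_def using B A C by (subst emeasure_distr) (auto intro!: arg_cong[where f = "emeasure M"])
    finally show "emeasure J1 C = emeasure J2 C" by simp
  qed auto
  then have "(\<integral>\<^sup>+x. \<phi> x \<partial>J2) = (\<integral>\<^sup>+x. \<phi> x \<partial>J1)" by simp
  also have "\<dots> = (\<integral>\<^sup>+\<omega>. \<phi> (\<omega>, Y \<omega>) \<partial>M)"
    unfolding J1_def using \<phi> by (subst nn_integral_distr) auto
  finally show ?thesis using J2[OF \<phi>] by simp
qed

text \<open>\<open>n 1\<close> and \<open>n (-1)\<close> are the integrals of the positive and
  negative parts. The nonnegative version gives both a finite mean, so that they are finite almost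
  surely.\<close>

lemma integral_disintegration:
  fixes h :: "'w \<times> 's \<Rightarrow> real"
  assumes M: "prob_space M" and sub: "subalgebra M H" and Y[measurable]: "Y \<in> measurable M S"
    and \<kappa>: "conditional_distribution M H Y S \<kappa>"
    and h[measurable]: "h \<in> borel_measurable (H \<Otimes>\<^sub>M S)"
    and int: "integrable M (\<lambda>\<omega>. h (\<omega>, Y \<omega>))"
  shows "AE \<omega> in M. integrable (\<kappa> \<omega>) (\<lambda>z. h (\<omega>, z))"
    and "integrable M (\<lambda>\<omega>. \<integral>z. h (\<omega>, z) \<partial>\<kappa> \<omega>)"
    and "(\<integral>\<omega>. \<integral>z. h (\<omega>, z) \<partial>\<kappa> \<omega> \<partial>M) = (\<integral>\<omega>. h (\<omega>, Y \<omega>) \<partial>M)"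
proof -
  note kD = conditional_distributionD[OF \<kappa>]
  have spH: "space H = space M" using sub by (simp add: subalgebra_def)
  define n where "n s \<omega> = (\<integral>\<^sup>+z. ennreal (s * h (\<omega>, z)) \<partial>\<kappa> \<omega>)" for s :: real and \<omega>
  have nH: "n s \<in> borel_measurable H" for s
    unfolding n_def by (rule nn_integral_measurable_subprob_algebra2[OF _ kD(2)]) measurable
  have nM[measurable]: "n s \<in> borel_measurable M" for s
    using measurable_from_subalg[OF sub nH] .
  have ni: "(\<integral>\<^sup>+\<omega>. n s \<omega> \<partial>M) = (\<integral>\<^sup>+\<omega>. ennreal (s * h (\<omega>, Y \<omega>)) \<partial>M)" for s
    unfolding n_def
    by (rule nn_integral_disintegration[OF M sub Y \<kappa>, of "\<lambda>p. ennreal (s * h p)"]) measurable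
  have hm: "(\<lambda>z. h (\<omega>, z)) \<in> borel_measurable (\<kappa> \<omega>)" if "\<omega> \<in> space M" for \<omega>
    using that spH unfolding measurable_cong_sets[OF kD(4)[of \<omega>] refl]
    by (subst measurable_cong_sets[OF kD(4) refl]) auto
  have fin: "(\<integral>\<^sup>+\<omega>. n s \<omega> \<partial>M) < \<infinity>" for s
  proof -
    have "integrable M (\<lambda>\<omega>. s * h (\<omega>, Y \<omega>))" using int by simp
    then have "(\<integral>\<^sup>+\<omega>. ennreal (s * h (\<omega>, Y \<omega>)) \<partial>M) < \<infinity>"
      unfolding real_integrable_def by (simp add: less_top)
    then show ?thesis using ni by simp
  qed
  have AEfin: "AE \<omega> in M. n s \<omega> \<noteq> \<infinity>" for s
    using nn_integral_PInf_AE[OF nM] fin[of s] by auto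
  have ik: "integrable (\<kappa> \<omega>) (\<lambda>z. h (\<omega>, z)) \<longleftrightarrow> n 1 \<omega> \<noteq> \<infinity> \<and> n (-1) \<omega> \<noteq> \<infinity>" if "\<omega> \<in> space M" for \<omega>
    unfolding real_integrable_def using hm[OF that] by (auto simp: n_def)
  \<comment> \<open>The Bochner integral is 0 where \<open>h (\<omega>, _)\<close> is not
    integrable. Spelling out this default value expresses the inner integral everywhere by
    \<open>n 1\<close> and \<open>n (-1)\<close>, which yields its measurability.\<close>
  have ek: "(\<integral>z. h (\<omega>, z) \<partial>\<kappa> \<omega>) =
      (if n 1 \<omega> \<noteq> \<infinity> \<and> n (-1) \<omega> \<noteq> \<infinity> then enn2real (n 1 \<omega>) - enn2real (n (-1) \<omega>) else 0)"
    if "\<omega> \<in> space M" for \<omega>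
    using ik[OF that] real_lebesgue_integral_def[of "\<kappa> \<omega>" "\<lambda>z. h (\<omega>, z)"]
      not_integrable_integral_eq[of "\<kappa> \<omega>" "\<lambda>z. h (\<omega>, z)"]
    by (simp add: n_def)
  have bint: "AE \<omega> in M. integrable (\<kappa> \<omega>) (\<lambda>z. h (\<omega>, z)) \<and>
      (\<integral>z. h (\<omega>, z) \<partial>\<kappa> \<omega>) = enn2real (n 1 \<omega>) - enn2real (n (-1) \<omega>)"
    using AEfin[of 1] AEfin[of "-1"] AE_space
    by eventually_elim (auto simp: ik ek)
  then show "AE \<omega> in M. integrable (\<kappa> \<omega>) (\<lambda>z. h (\<omega>, z))" by (auto elim: eventually_mono)
  have e2: "(\<integral>\<^sup>+\<omega>. ennreal (enn2real (n s \<omega>)) \<partial>M) = (\<integral>\<^sup>+\<omega>. n s \<omega> \<partial>M)" for s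
    using AEfin[of s] by (intro nn_integral_cong_AE) (auto elim!: eventually_mono simp: top.not_eq_extremum)
  have ie: "integrable M (\<lambda>\<omega>. enn2real (n s \<omega>))" for s
    using e2[of s] fin[of s] by (intro integrableI_nonneg) auto
  have me: "(\<integral>\<omega>. enn2real (n s \<omega>) \<partial>M) = enn2real (\<integral>\<^sup>+\<omega>. ennreal (s * h (\<omega>, Y \<omega>)) \<partial>M)" for s
    by (subst integral_eq_nn_integral) (auto simp: e2 ni)
  have meas: "(\<lambda>\<omega>. \<integral>z. h (\<omega>, z) \<partial>\<kappa> \<omega>) \<in> borel_measurable M"
    by (subst measurable_cong[OF ek]) measurable
  have eqAE: "AE \<omega> in M. (\<integral>z. h (\<omega>, z) \<partial>\<kappa> \<omega>) = enn2real (n 1 \<omega>) - enn2real (n (-1) \<omega>)"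
    using bint by (auto elim: eventually_mono)
  show "integrable M (\<lambda>\<omega>. \<integral>z. h (\<omega>, z) \<partial>\<kappa> \<omega>)"
    using ie eqAE by (subst integrable_cong_AE[OF meas]) auto
  have "(\<integral>\<omega>. \<integral>z. h (\<omega>, z) \<partial>\<kappa> \<omega> \<partial>M) = (\<integral>\<omega>. enn2real (n 1 \<omega>) - enn2real (n (-1) \<omega>) \<partial>M)"
    using ie eqAE meas by (intro integral_cong_AE) auto
  also have "\<dots> = (\<integral>\<omega>. h (\<omega>, Y \<omega>) \<partial>M)"
    using ie by (simp add: me real_lebesgue_integral_def[OF int])
  finally show "(\<integral>\<omega>. \<integral>z. h (\<omega>, z) \<partial>\<kappa> \<omega> \<partial>M) = (\<integral>\<omega>. h (\<omega>, Y \<omega>) \<partial>M)" .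
qed

section \<open>Ergodic mirror descent\<close>

lemma space_hist [simp]: "space (hist M \<nu> \<xi> t) = space M"
  by (simp add: hist_def space_measure_of_conv)

lemma sets_hist:
  "sets (hist M \<nu> \<xi> t) = sigma_sets (space M) (\<Union>i\<in>{1..t}. {\<xi> i -` A \<inter> space M | A. A \<in> sets \<nu>})"
  unfolding hist_def by (rule sets_measure_of) auto

lemma sets_hist_mono: "s \<le> t \<Longrightarrow> sets (hist M \<nu> \<xi> s) \<subseteq> sets (hist M \<nu> \<xi> t)"
  unfolding sets_hist by (intro sigma_sets_mono' UN_mono) auto

lemma subalgebra_hist:
  assumes "\<And>t. t \<ge> 1 \<Longrightarrow> \<xi> t \<in> measurable M \<nu>"
  shows "subalgebra M (hist M \<nu> \<xi> t)"
  unfolding subalgebra_def sets_hist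
  using assms by (auto intro!: sets.sigma_sets_subset intro: measurable_sets)

lemma measurable_hist:
  assumes "\<And>t. t \<ge> 1 \<Longrightarrow> \<xi> t \<in> measurable M \<nu>" "1 \<le> i" "i \<le> t"
  shows "\<xi> i \<in> measurable (hist M \<nu> \<xi> t) \<nu>"
proof (rule measurableI)
  show "\<xi> i \<omega> \<in> space \<nu>" if "\<omega> \<in> space (hist M \<nu> \<xi> t)" for \<omega>
    using measurable_space[OF assms(1)[OF assms(2)]] that by simp
  show "\<xi> i -` A \<inter> space (hist M \<nu> \<xi> t) \<in> sets (hist M \<nu> \<xi> t)" if "A \<in> sets \<nu>" for A
    unfolding sets_hist space_hist by (rule sigma_sets.Basic) (use assms that in force)
qed

section \<open>The common setting: adapted iterates and pathwise estimates\<close>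

locale emd_setting = prob_space M + \<nu>: prob_space \<nu>
  for M :: "'w measure" and \<nu> :: "'s measure" +
  fixes \<xi> :: "nat \<Rightarrow> 'w \<Rightarrow> 's"
    and X :: "'a::euclidean_space set" and N :: "'a \<Rightarrow> real"
    and Dom :: "'s \<Rightarrow> 'a set" and F :: "'a \<Rightarrow> 's \<Rightarrow> real" and sg :: "'a \<Rightarrow> 's \<Rightarrow> 'a"
    and \<psi> :: "'a \<Rightarrow> real" and \<psi>' :: "'a \<Rightarrow> 'a"
    and \<alpha> :: "nat \<Rightarrow> real" and x :: "nat \<Rightarrow> 'w \<Rightarrow> 'a" and x1 xstar :: 'a
    and \<kappa> :: "nat \<Rightarrow> nat \<Rightarrow> 'w \<Rightarrow> 's measure" and \<tau>TV \<tau>hel :: "real \<Rightarrow> nat"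
    and R G :: real
  assumes \<xi>: "\<And>t. t \<ge> 1 \<Longrightarrow> \<xi> t \<in> measurable M \<nu>"
    and N: "is_norm N"
    and X: "compact X" "convex X"
    and Dom: "\<And>z. z \<in> space \<nu> \<Longrightarrow> X \<subseteq> Dom z"
    and F_int: "\<And>y. y \<in> X \<Longrightarrow> integrable \<nu> (F y)"
    and sg: "\<And>y z. y \<in> X \<Longrightarrow> z \<in> space \<nu> \<Longrightarrow> sg y z \<in> subdifferential (Dom z) (\<lambda>y. F y z) y"
    and sg_meas: "(\<lambda>(y, z). sg y z) \<in> borel_measurable (restrict_space borel X \<Otimes>\<^sub>M \<nu>)"
    and prox: "prox_function N X \<psi> \<psi>'"
    and R: "0 \<le> R" "\<And>y z. y \<in> X \<Longrightarrow> z \<in> X \<Longrightarrow> bregman \<psi> \<psi>' y z \<le> R\<^sup>2 / 2"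
    and \<alpha>: "\<And>t. t \<ge> 1 \<Longrightarrow> 0 < \<alpha> t" "\<And>t. t \<ge> 1 \<Longrightarrow> \<alpha> (Suc t) \<le> \<alpha> t"
    and x1: "x1 \<in> X" and emd: "emd_iterates M X \<psi> \<psi>' sg \<alpha> \<xi> x1 x"
    and \<kappa>: "\<And>s t. s < t \<Longrightarrow> conditional_distribution M (hist M \<nu> \<xi> s) (\<xi> t) \<nu> (\<kappa> s t)"
    and TV: "uniform_mixing_time M tv_dist \<nu> \<kappa> \<tau>TV" "mixed_at M tv_dist \<nu> \<kappa> \<tau>TV"
    and hel: "uniform_mixing_time M hel_dist \<nu> \<kappa> \<tau>hel" "mixed_at M hel_dist \<nu> \<kappa> \<tau>hel"
    and xstar: "xstar \<in> X" and G: "0 \<le> G"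
begin

abbreviation "H \<equiv> hist M \<nu> \<xi>"
abbreviation "sgnorm y z \<equiv> dual_norm N (sg y z)"
abbreviation "regret t \<omega> \<equiv> objective \<nu> F (x t \<omega>) - objective \<nu> F xstar"
abbreviation "excess t p \<equiv> F (x t (fst p)) (snd p) - F xstar (snd p)"

lemma subalg: "subalgebra M (H t)"
  using \<xi> by (rule subalgebra_hist)

lemma measurable_hist_mono: "f \<in> measurable (H s) K \<Longrightarrow> s \<le> t \<Longrightarrow> f \<in> measurable (H t) K"
  by (rule measurable_from_subalg) (auto simp: subalgebra_def sets_hist_mono)

lemma \<xi>_in: "t \<ge> 1 \<Longrightarrow> \<omega> \<in> space M \<Longrightarrow> \<xi> t \<omega> \<in> space \<nu>"
  using \<xi> by (rule measurable_space)

text \<open>Lags start at 1, so no mixing time is below 1, and a constant statement that holds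
  almost surely on a probability space is true. It makes \<open>\<tau> \<epsilon> - 1\<close> an
  honest natural number of delay steps.\<close>

lemma mixing_time_pos:
  assumes "uniform_mixing_time M d \<nu> \<kappa> \<tau>" "0 < \<epsilon>"
  shows "1 \<le> \<tau> \<epsilon>"
proof -
  have "AE \<omega> in M. 1 \<le> \<tau> \<epsilon>"
    using assms(1) unfolding uniform_mixing_time_def
  proof eventually_elim
    case (elim \<omega>)
    have "enat 1 \<le> mixing_time d \<nu> \<kappa> 0 \<epsilon> \<omega>"
      unfolding mixing_time_def by (auto simp: le_Inf_iff)
    also have "\<dots> \<le> enat (\<tau> \<epsilon>)" using elim assms(2) by auto
    finally show ?case by simp
  qed
  then show ?thesis by simp
qed

lemma x_argmin:
  assumes "t \<ge> 1" "\<omega> \<in> space M"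
  shows "is_arg_min (\<lambda>y. sg (x t \<omega>) (\<xi> t \<omega>) \<bullet> y + (1 / \<alpha> t) * bregman \<psi> \<psi>' y (x t \<omega>))
           (\<lambda>y. y \<in> X) (x (Suc t) \<omega>)"
  using emd assms unfolding emd_iterates_def by blast

lemma x_in: "t \<ge> 1 \<Longrightarrow> \<omega> \<in> space M \<Longrightarrow> x t \<omega> \<in> X"
proof (induction t rule: nat_induct_at_least)
  case base
  then show ?case using emd x1 by (auto simp: emd_iterates_def)
next
  case (Suc n)
  then show ?case using x_argmin[of n \<omega>] by (simp add: is_arg_min_linorder)
qed

lemma sg_comp_measurable:
  assumes "y \<in> borel_measurable A" "\<And>\<omega>. \<omega> \<in> space A \<Longrightarrow> y \<omega> \<in> X" "z \<in> measurable A \<nu>"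
  shows "(\<lambda>\<omega>. sg (y \<omega>) (z \<omega>)) \<in> borel_measurable A"
proof -
  have "(\<lambda>\<omega>. (y \<omega>, z \<omega>)) \<in> measurable A (restrict_space borel X \<Otimes>\<^sub>M \<nu>)"
    using assms by (intro measurable_Pair measurable_restrict_space2) auto
  from measurable_compose[OF this sg_meas] show ?thesis by simp
qed

text \<open>The index \<open>t - 1\<close> is the one that matters: the step to \<open>x t\<close>
  uses the samples up to \<open>\<xi> (t - 1)\<close>, so \<open>x t\<close> is frozen when the law
  of a later sample is conditioned on \<open>H (t - 1)\<close>.\<close>

lemma x_measurable: "t \<ge> 1 \<Longrightarrow> x t \<in> borel_measurable (H (t - 1))"
proof (induction t rule: nat_induct_at_least)
  case base
  have "x 1 \<omega> = x1" if "\<omega> \<in> space M" for \<omega>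
    using emd that by (auto simp: emd_iterates_def)
  then show ?case by (subst measurable_cong[where g = "\<lambda>_. x1"]) auto
next
  case (Suc n)
  then have xn: "x n \<in> borel_measurable (H n)"
    by (intro measurable_hist_mono[OF Suc.IH]) auto
  have "x (Suc n) \<in> borel_measurable (H n)"
  proof (rule prox_step_measurable[OF N prox X \<alpha>(1)[OF Suc.hyps] xn])
    show "(\<lambda>\<omega>. sg (x n \<omega>) (\<xi> n \<omega>)) \<in> borel_measurable (H n)"
      using Suc.hyps x_in by (intro sg_comp_measurable xn measurable_hist[OF \<xi>]) auto
  qed (use x_in x_argmin Suc.hyps in auto)
  then show ?case by simp
qed

lemma sgnorm_measurable:
  assumes "y \<in> borel_measurable A" "\<And>\<omega>. \<omega> \<in> space A \<Longrightarrow> y \<omega> \<in> X" "z \<in> measurable A \<nu>"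
  shows "(\<lambda>\<omega>. sgnorm (y \<omega>) (z \<omega>)) \<in> borel_measurable A"
  using measurable_compose[OF sg_comp_measurable[OF assms] dual_norm_measurable[OF N]] .

lemma sgnorm_nonneg: "0 \<le> sgnorm y z"
  by (rule dual_norm_nonneg[OF N])

text \<open>Strong convexity turns the bound on the Bregman divergence into a bound on the diameter
  of \<open>X\<close>.\<close>

lemma N_le_R:
  assumes "y \<in> X" "y' \<in> X" shows "N (y - y') \<le> R"
proof -
  have "(N (y - y'))\<^sup>2 \<le> R\<^sup>2"
    using prox_functionD(2)[OF prox assms(2,1)] R(2)[OF assms(2,1)] by linarith
  then show ?thesis using R(1) by (rule power2_le_imp_le)
qed

lemma F_diff_le_inner:
  assumes "y \<in> X" "y' \<in> X" "z \<in> space \<nu>"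
  shows "F y z - F y' z \<le> sg y z \<bullet> (y - y')"
  using sg[OF assms(1,3)] Dom[OF assms(3)] assms(2)
  by (force simp: subdifferential_def inner_diff_right)

lemma F_diff_le:
  assumes "y \<in> X" "y' \<in> X" "z \<in> space \<nu>"
  shows "F y z - F y' z \<le> sgnorm y z * N (y - y')"
  using F_diff_le_inner[OF assms] inner_le_dual_norm[OF N, of "sg y z" "y - y'"] by linarith

text \<open>A subgradient bounds an increment from one side only, so the absolute value involves the
  subgradients at both points. In the squared form this costs the factor 2 in
  \<open>2 * G\<^sup>2 * R\<^sup>2\<close>.\<close>

lemma abs_F_diff_le:
  assumes "y \<in> X" "y' \<in> X" "z \<in> space \<nu>"
  shows "\<bar>F y z - F y' z\<bar> \<le> max (sgnorm y z) (sgnorm y' z) * R"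
proof -
  have "sgnorm y z * N (y - y') \<le> max (sgnorm y z) (sgnorm y' z) * R"
    using N_le_R[OF assms(1,2)] sgnorm_nonneg is_norm_nonneg[OF N]
    by (intro mult_mono) (auto simp: le_max_iff_disj)
  moreover have "sgnorm y' z * N (y' - y) \<le> max (sgnorm y z) (sgnorm y' z) * R"
    using N_le_R[OF assms(2,1)] sgnorm_nonneg is_norm_nonneg[OF N]
    by (intro mult_mono) (auto simp: le_max_iff_disj)
  ultimately show ?thesis
    using F_diff_le[OF assms] F_diff_le[OF assms(2,1,3)] by linarith
qed

lemma F_diff_square_le:
  assumes "y \<in> X" "y' \<in> X" "z \<in> space \<nu>"
  shows "(F y z - F y' z)\<^sup>2 \<le> R\<^sup>2 * ((sgnorm y z)\<^sup>2 + (sgnorm y' z)\<^sup>2)"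
proof -
  have "(F y z - F y' z)\<^sup>2 \<le> (max (sgnorm y z) (sgnorm y' z) * R)\<^sup>2"
    using abs_F_diff_le[OF assms] by (subst abs_le_square_iff[symmetric]) linarith
  also have "\<dots> = R\<^sup>2 * (max (sgnorm y z) (sgnorm y' z))\<^sup>2"
    by (simp add: power_mult_distrib)
  also have "\<dots> \<le> R\<^sup>2 * ((sgnorm y z)\<^sup>2 + (sgnorm y' z)\<^sup>2)"
    by (intro mult_left_mono) (auto simp: max_def)
  finally show ?thesis .
qed

text \<open>The product space separates the history, on which \<open>x t\<close> depends, from the
  sample inserted into \<open>F\<close>; the sample can then be drawn from \<open>\<kappa>\<close>,
  from \<open>\<nu>\<close> or along the process.\<close>

lemma excess_measurable:
  assumes "t \<ge> 1" shows "excess t \<in> borel_measurable (H (t - 1) \<Otimes>\<^sub>M \<nu>)"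
proof -
  have "(\<lambda>p. (x t (fst p), snd p)) \<in> measurable (H (t - 1) \<Otimes>\<^sub>M \<nu>) (restrict_space borel X \<Otimes>\<^sub>M \<nu>)"
    using x_measurable[OF assms] x_in[OF assms]
    by (intro measurable_Pair measurable_restrict_space2) (auto simp: space_pair_measure)
  from measurable_compose[OF this subgradient_increment_measurable[OF X(2) Dom sg sg_meas xstar]]
  show ?thesis by simp
qed

lemma excess_measurable_M:
  assumes "t \<ge> 1" "u \<ge> t"
  shows "(\<lambda>\<omega>. excess t (\<omega>, \<xi> u \<omega>)) \<in> borel_measurable M"
proof -
  have "(\<lambda>\<omega>. (\<omega>, \<xi> u \<omega>)) \<in> measurable M (H (t - 1) \<Otimes>\<^sub>M \<nu>)"
    using assms by (intro measurable_Pair \<xi> measurable_from_subalg[OF subalg measurable_ident_sets]) auto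
  from measurable_compose[OF this excess_measurable[OF assms(1)]] show ?thesis .
qed

lemma regret_eq:
  assumes "t \<ge> 1" "\<omega> \<in> space M"
  shows "regret t \<omega> = (\<integral>z. excess t (\<omega>, z) \<partial>\<nu>)"
  unfolding objective_def using F_int[OF x_in[OF assms]] F_int[OF xstar] by simp

text \<open>Measurability of \<open>objective\<close> in its point is not assumed. It is obtained
  for increments along the iterates, by integrating the jointly measurable \<open>excess\<close>
  over the sample.\<close>

lemma regret_measurable:
  assumes "t \<ge> 1" shows "regret t \<in> borel_measurable M"
proof -
  have "(\<lambda>\<omega>. \<integral>z. excess t (\<omega>, z) \<partial>\<nu>) \<in> borel_measurable (H (t - 1))"
    by (rule \<nu>.borel_measurable_lebesgue_integral) (use excess_measurable[OF assms] in \<open>simp add: case_prod_beta'\<close>)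
  then have "(\<lambda>\<omega>. \<integral>z. excess t (\<omega>, z) \<partial>\<nu>) \<in> borel_measurable M"
    by (rule measurable_from_subalg[OF subalg])
  then show ?thesis
    by (subst measurable_cong[OF regret_eq[OF assms]]) auto
qed

text \<open>Summation by parts of the one-step inequality. The sum starts at a general
  \<open>m\<close> because the delayed samples begin at \<open>1 + k\<close>; for \<open>m\<close>
  beyond \<open>T\<close> it is empty and the bound is merely nonnegative.\<close>

lemma regret_telescope:
  assumes w: "\<omega> \<in> space M" and "1 \<le> m" "1 \<le> T"
  shows "(\<Sum>u=m..T. sg (x u \<omega>) (\<xi> u \<omega>) \<bullet> (x u \<omega> - xstar))
    \<le> R\<^sup>2 / (2 * \<alpha> T) + (\<Sum>u=m..T. \<alpha> u / 2 * (sgnorm (x u \<omega>) (\<xi> u \<omega>))\<^sup>2)"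
proof -
  let ?D = "\<lambda>u. bregman \<psi> \<psi>' xstar (x u \<omega>)"
  have one_step: "sg (x u \<omega>) (\<xi> u \<omega>) \<bullet> (x u \<omega> - xstar)
      \<le> (1 / \<alpha> u) * (?D u - ?D (Suc u)) + \<alpha> u / 2 * (sgnorm (x u \<omega>) (\<xi> u \<omega>))\<^sup>2" if "u \<ge> 1" for u
    by (rule prox_step_regret[OF N prox X(2) \<alpha>(1)[OF that] x_in[OF that w] x_argmin[OF that w] xstar])
  have D0: "0 \<le> ?D u" if "u \<ge> 1" for u
    using prox_functionD(2)[OF prox xstar x_in[OF that w]]
      zero_le_power2[of "N (x u \<omega> - xstar)"] by linarith
  have main: "(\<Sum>u=m..T. sg (x u \<omega>) (\<xi> u \<omega>) \<bullet> (x u \<omega> - xstar))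
    \<le> R\<^sup>2 / (2 * \<alpha> T) - ?D (Suc T) / \<alpha> T + (\<Sum>u=m..T. \<alpha> u / 2 * (sgnorm (x u \<omega>) (\<xi> u \<omega>))\<^sup>2)"
    if "m \<le> T" using that
  proof (induction T rule: dec_induct)
    case base
    have "?D m / \<alpha> m \<le> (R\<^sup>2 / 2) / \<alpha> m"
      using \<alpha>(1)[OF \<open>1 \<le> m\<close>] by (intro divide_right_mono R xstar x_in w) (use \<open>1 \<le> m\<close> in auto)
    then show ?case using one_step[OF \<open>1 \<le> m\<close>] by (simp add: diff_divide_distrib)
  next
    case (step n)
    have n1: "1 \<le> n" "1 \<le> Suc n" using step.hyps \<open>1 \<le> m\<close> by auto
    \<comment> \<open>The induction keeps the negative term with weight
      \<open>1 / \<alpha> n\<close>. As the stepsizes do not increase, raising this weight to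
      \<open>1 / \<alpha> (Suc n)\<close> costs at most R^2/2 times the increase, and these
      increases telescope.\<close>
    have "0 \<le> (R\<^sup>2 / 2 - ?D (Suc n)) * (1 / \<alpha> (Suc n) - 1 / \<alpha> n)"
      using R(2)[OF xstar x_in[OF n1(2) w]] \<alpha>(1)[OF n1(1)] \<alpha>(1)[OF n1(2)] \<alpha>(2)[OF n1(1)]
      by (intro mult_nonneg_nonneg) (auto intro!: divide_left_mono mult_pos_pos)
    then have "R\<^sup>2 / (2 * \<alpha> n) - ?D (Suc n) / \<alpha> n + (1 / \<alpha> (Suc n)) * ?D (Suc n) \<le> R\<^sup>2 / (2 * \<alpha> (Suc n))"
      by (simp add: algebra_simps)
    with one_step[OF n1(2)] step.IH show ?case
      using step.hyps by (simp add: algebra_simps)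
  qed
  show ?thesis
  proof (cases "m \<le> T")
    case True
    have "0 \<le> ?D (Suc T) / \<alpha> T" using D0[of "Suc T"] \<alpha>(1)[OF \<open>1 \<le> T\<close>] by simp
    then show ?thesis using main[OF True] by linarith
  next
    case False
    then show ?thesis using \<alpha>(1)[OF \<open>1 \<le> T\<close>] by simp
  qed
qed

lemma x_drift:
  assumes w: "\<omega> \<in> space M" and "1 \<le> t"
  shows "N (x t \<omega> - x (t + k) \<omega>) \<le> (\<Sum>s\<in>{t..<t + k}. \<alpha> s * sgnorm (x s \<omega>) (\<xi> s \<omega>))"
proof (induction k)
  case 0
  then show ?case using is_norm_zero[OF N] by simp
next
  case (Suc k)
  have t: "1 \<le> t + k" using assms by simp
  have "N (x (Suc (t + k)) \<omega> - x (t + k) \<omega>) \<le> \<alpha> (t + k) * sgnorm (x (t + k) \<omega>) (\<xi> (t + k) \<omega>)"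
    by (rule prox_step_length[OF N prox X(2) \<alpha>(1)[OF t] x_in[OF t w] x_argmin[OF t w]])
  moreover have "N (x t \<omega> - x (t + Suc k) \<omega>) \<le>
      N (x t \<omega> - x (t + k) \<omega>) + N (x (Suc (t + k)) \<omega> - x (t + k) \<omega>)"
    using is_norm_triangle[OF N, of "x t \<omega> - x (t + k) \<omega>" "x (t + k) \<omega> - x (Suc (t + k)) \<omega>"]
      is_norm_commute[OF N, of "x (Suc (t + k)) \<omega>" "x (t + k) \<omega>"] by simp
  ultimately show ?case using Suc by simp
qed

lemma \<alpha>_antimono: "s \<le> t \<Longrightarrow> 1 \<le> s \<Longrightarrow> \<alpha> t \<le> \<alpha> s"
  by (induction t rule: dec_induct) (auto intro: order_trans[OF \<alpha>(2)])

end

text \<open>The common consequence of the two assumptions on the subgradients. The point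
  \<open>y\<close> is any one chosen before the sample is seen: it will be the current iterate, an
  earlier iterate \<open>x t\<close> paired with a later \<open>\<xi> u\<close>, or a
  constant.\<close>

locale emd_second_moment = emd_setting +
  assumes second_moment: "\<And>t y. t \<ge> 1 \<Longrightarrow> y \<in> borel_measurable (H (t - 1)) \<Longrightarrow>
    (\<And>\<omega>. \<omega> \<in> space M \<Longrightarrow> y \<omega> \<in> X) \<Longrightarrow>
    (\<integral>\<^sup>+\<omega>. ennreal ((sgnorm (y \<omega>) (\<xi> t \<omega>))\<^sup>2) \<partial>M) \<le> ennreal (G\<^sup>2)"
begin

lemma second_moment_integral:
  assumes "t \<ge> 1" "y \<in> borel_measurable (H (t - 1))" "\<And>\<omega>. \<omega> \<in> space M \<Longrightarrow> y \<omega> \<in> X"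
  shows "integrable M (\<lambda>\<omega>. (sgnorm (y \<omega>) (\<xi> t \<omega>))\<^sup>2)"
    and "(\<integral>\<omega>. (sgnorm (y \<omega>) (\<xi> t \<omega>))\<^sup>2 \<partial>M) \<le> G\<^sup>2"
proof -
  have m: "(\<lambda>\<omega>. (sgnorm (y \<omega>) (\<xi> t \<omega>))\<^sup>2) \<in> borel_measurable M"
    using assms \<xi> measurable_from_subalg[OF subalg assms(2)]
    by (intro borel_measurable_power sgnorm_measurable) auto
  show "integrable M (\<lambda>\<omega>. (sgnorm (y \<omega>) (\<xi> t \<omega>))\<^sup>2)"
    using m second_moment[OF assms] by (intro integrableI_nonneg) (auto intro: le_less_trans)
  show "(\<integral>\<omega>. (sgnorm (y \<omega>) (\<xi> t \<omega>))\<^sup>2 \<partial>M) \<le> G\<^sup>2"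
    using second_moment[OF assms] m by (subst integral_eq_nn_integral) (auto intro!: enn2real_leI)
qed

lemma iterate_second_moment:
  assumes "1 \<le> t" "t \<le> u"
  shows "integrable M (\<lambda>\<omega>. (sgnorm (x t \<omega>) (\<xi> u \<omega>))\<^sup>2)"
    and "(\<integral>\<omega>. (sgnorm (x t \<omega>) (\<xi> u \<omega>))\<^sup>2 \<partial>M) \<le> G\<^sup>2"
  using assms x_in by (intro second_moment_integral measurable_hist_mono[OF x_measurable]; auto)+

lemma const_second_moment:
  assumes "1 \<le> u" "y \<in> X"
  shows "integrable M (\<lambda>\<omega>. (sgnorm y (\<xi> u \<omega>))\<^sup>2)"
    and "(\<integral>\<omega>. (sgnorm y (\<xi> u \<omega>))\<^sup>2 \<partial>M) \<le> G\<^sup>2"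
  using assms by (intro second_moment_integral; auto)+

text \<open>Total variation mixing at arbitrarily small levels transfers the bound for the samples to \<open>\<nu>\<close>, for
  bounded functions at first. In the Hellinger case this is what bounds \<open>f (x t) - f xstar\<close> by \<open>G R\<close>.\<close>

lemma target_second_moment_truncated:
  assumes y: "y \<in> X"
  shows "(\<integral>z. min ((sgnorm y z)\<^sup>2) (real K) \<partial>\<nu>) \<le> G\<^sup>2"
proof (rule field_le_epsilon)
  fix e :: real assume e: "0 < e"
  \<comment> \<open>The truncated function is bounded by \<open>K\<close>, so a total variation
    distance \<open>e'\<close> costs at most \<open>real K * e'\<close>; the summand 1 covers
    \<open>K = 0\<close>.\<close>
  define e' where "e' = e / (real K + 1)"
  have e': "0 < e'" "real K * e' \<le> e" using e by (auto simp: e'_def field_simps)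
  \<comment> \<open>Conditioned on the trivial \<open>H 0\<close>, the sample at time
    \<open>\<tau>TV e'\<close> has a law within \<open>e'\<close> of the target, and its second
    moment is bounded by assumption.\<close>
  define u where "u = \<tau>TV e'"
  have u: "1 \<le> u" unfolding u_def by (rule mixing_time_pos[OF TV(1) e'(1)])
  define b where "b z = min ((sgnorm y z)\<^sup>2) (real K)" for z
  have b[measurable]: "b \<in> borel_measurable \<nu>"
    unfolding b_def using y by (intro borel_measurable_min borel_measurable_power sgnorm_measurable) auto
  have b_bd: "\<bar>b z\<bar> \<le> real K" "b z \<le> (sgnorm y z)\<^sup>2" for z by (auto simp: b_def)
  have bu: "integrable M (\<lambda>\<omega>. b (\<xi> u \<omega>))"
    using measurable_compose[OF \<xi>[OF u] b] b_bd(1) by (intro integrable_const_bound[of _ "real K"]) auto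
  have \<kappa>u: "conditional_distribution M (H 0) (\<xi> u) \<nu> (\<kappa> 0 u)"
    using u by (intro \<kappa>) auto
  note D = integral_disintegration[OF prob_space_axioms subalg \<xi>[OF u] \<kappa>u, of "\<lambda>p. b (snd p)"]
  have i: "integrable M (\<lambda>\<omega>. \<integral>z. b z \<partial>\<kappa> 0 u \<omega>)"
    "(\<integral>\<omega>. \<integral>z. b z \<partial>\<kappa> 0 u \<omega> \<partial>M) = (\<integral>\<omega>. b (\<xi> u \<omega>) \<partial>M)"
    using D(2,3) bu by auto
  have "AE \<omega> in M. (\<integral>z. b z \<partial>\<nu>) \<le> (\<integral>z. b z \<partial>\<kappa> 0 u \<omega>) + e"
    using TV(2)[unfolded mixed_at_def] AE_space
  proof eventually_elim
    case (elim \<omega>)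
    note kD = conditional_distributionD[OF \<kappa>u]
    have tv: "tv_dist (\<kappa> 0 u \<omega>) \<nu> \<le> e'" using elim(1) e'(1) unfolding u_def by (metis add_0)
    have "(\<integral>z. b z \<partial>\<nu>) - (\<integral>z. b z \<partial>\<kappa> 0 u \<omega>) \<le> real K * tv_dist (\<kappa> 0 u \<omega>) \<nu>"
      using elim(2) kD(3,4)[of \<omega>] b_bd(1) b
      by (intro expectation_diff_le_tv_dist \<nu>.prob_space_axioms)
        (auto cong: measurable_cong_sets)
    also have "\<dots> \<le> real K * e'" using tv by (intro mult_left_mono) auto
    finally show ?case using e' by linarith
  qed
  then have "(\<integral>\<omega>. (\<integral>z. b z \<partial>\<nu>) \<partial>M) \<le> (\<integral>\<omega>. (\<integral>z. b z \<partial>\<kappa> 0 u \<omega>) + e \<partial>M)"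
    using i by (intro integral_mono_AE) auto
  then have "(\<integral>z. b z \<partial>\<nu>) \<le> (\<integral>\<omega>. b (\<xi> u \<omega>) \<partial>M) + e"
    using i by (simp add: prob_space)
  also have "(\<integral>\<omega>. b (\<xi> u \<omega>) \<partial>M) \<le> (\<integral>\<omega>. (sgnorm y (\<xi> u \<omega>))\<^sup>2 \<partial>M)"
    using bu const_second_moment(1)[OF u y] b_bd(2) by (intro integral_mono) auto
  also have "\<dots> \<le> G\<^sup>2" by (rule const_second_moment(2)[OF u y])
  finally show "(\<integral>z. min ((sgnorm y z)\<^sup>2) (real K) \<partial>\<nu>) \<le> G\<^sup>2 + e" by (simp add: b_def)
qed

text \<open>Monotone convergence removes the truncation. It is carried out for the extended
  integral, because integrability is itself part of the claim.\<close>

lemma target_second_moment: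
  assumes y: "y \<in> X"
  shows "integrable \<nu> (\<lambda>z. (sgnorm y z)\<^sup>2)" "(\<integral>z. (sgnorm y z)\<^sup>2 \<partial>\<nu>) \<le> G\<^sup>2"
proof -
  have m[measurable]: "(\<lambda>z. (sgnorm y z)\<^sup>2) \<in> borel_measurable \<nu>"
    using y by (intro borel_measurable_power sgnorm_measurable) auto
  have le: "(\<integral>\<^sup>+z. ennreal (min ((sgnorm y z)\<^sup>2) (real n)) \<partial>\<nu>) \<le> ennreal (G\<^sup>2)" for n
  proof -
    have "integrable \<nu> (\<lambda>z. min ((sgnorm y z)\<^sup>2) (real n))"
      by (intro \<nu>.integrable_const_bound[of _ "real n"]) auto
    then have "(\<integral>\<^sup>+z. ennreal (min ((sgnorm y z)\<^sup>2) (real n)) \<partial>\<nu>)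
        = ennreal (\<integral>z. min ((sgnorm y z)\<^sup>2) (real n) \<partial>\<nu>)"
      by (intro nn_integral_eq_integral) auto
    then show ?thesis using target_second_moment_truncated[OF y] by (simp add: ennreal_leI)
  qed
  have "(\<lambda>n. \<integral>\<^sup>+z. ennreal (min ((sgnorm y z)\<^sup>2) (real n)) \<partial>\<nu>) \<longlonglongrightarrow> (\<integral>\<^sup>+z. ennreal ((sgnorm y z)\<^sup>2) \<partial>\<nu>)"
  proof (rule nn_integral_LIMSEQ)
    show "incseq (\<lambda>n z. ennreal (min ((sgnorm y z)\<^sup>2) (real n)))"
      by (auto simp: incseq_def le_fun_def intro!: ennreal_leI)
    show "(\<lambda>n. ennreal (min ((sgnorm y z)\<^sup>2) (real n))) \<longlonglongrightarrow> ennreal ((sgnorm y z)\<^sup>2)" for z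
    proof (rule tendsto_eventually)
      show "\<forall>\<^sub>F n in sequentially. ennreal (min ((sgnorm y z)\<^sup>2) (real n)) = ennreal ((sgnorm y z)\<^sup>2)"
        using eventually_ge_at_top[of "nat \<lceil>(sgnorm y z)\<^sup>2\<rceil>"]
      proof eventually_elim
        case (elim n)
        then have "(sgnorm y z)\<^sup>2 \<le> real n" by linarith
        then show ?case by simp
      qed
    qed
  qed measurable
  then have nn: "(\<integral>\<^sup>+z. ennreal ((sgnorm y z)\<^sup>2) \<partial>\<nu>) \<le> ennreal (G\<^sup>2)"
    by (rule LIMSEQ_le_const2) (use le in auto)
  then show "integrable \<nu> (\<lambda>z. (sgnorm y z)\<^sup>2)"
    by (intro integrableI_nonneg) (auto intro: le_less_trans)
  show "(\<integral>z. (sgnorm y z)\<^sup>2 \<partial>\<nu>) \<le> G\<^sup>2"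
    using nn by (subst integral_eq_nn_integral) (auto intro!: enn2real_leI)
qed

lemma target_first_moment:
  assumes y: "y \<in> X"
  shows "integrable \<nu> (sgnorm y)" "(\<integral>z. sgnorm y z \<partial>\<nu>) \<le> G"
proof -
  have m: "sgnorm y \<in> borel_measurable \<nu>" using y by (intro sgnorm_measurable) auto
  show i: "integrable \<nu> (sgnorm y)"
    by (rule \<nu>.square_integrable_imp_integrable[OF m target_second_moment(1)[OF y]])
  have "(\<integral>z. sgnorm y z \<partial>\<nu>)\<^sup>2 \<le> (\<integral>z. (sgnorm y z)\<^sup>2 \<partial>\<nu>)"
    using \<nu>.variance_eq[OF i target_second_moment(1)[OF y]] \<nu>.variance_positive[of "sgnorm y"] by linarith
  also have "\<dots> \<le> G\<^sup>2" by (rule target_second_moment(2)[OF y])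
  finally show "(\<integral>z. sgnorm y z \<partial>\<nu>) \<le> G" using G by (rule power2_le_imp_le)
qed

lemma objective_diff_le:
  assumes "y \<in> X" "y' \<in> X"
  shows "objective \<nu> F y - objective \<nu> F y' \<le> G * R"
proof -
  have "objective \<nu> F y - objective \<nu> F y' = (\<integral>z. F y z - F y' z \<partial>\<nu>)"
    unfolding objective_def using F_int assms by simp
  also have "\<dots> \<le> (\<integral>z. sgnorm y z * N (y - y') \<partial>\<nu>)"
    using F_int assms target_first_moment(1) F_diff_le by (intro integral_mono) auto
  also have "\<dots> = (\<integral>z. sgnorm y z \<partial>\<nu>) * N (y - y')" by simp
  also have "\<dots> \<le> G * R"
    using target_first_moment(2)[OF assms(1)] G N_le_R[OF assms] is_norm_nonneg[OF N]
    by (intro mult_mono) auto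
  finally show ?thesis .
qed

lemma regret_le: "t \<ge> 1 \<Longrightarrow> \<omega> \<in> space M \<Longrightarrow> regret t \<omega> \<le> G * R"
  by (intro objective_diff_le x_in xstar)

lemma regret_integrable:
  assumes "t \<ge> 1" shows "integrable M (regret t)"
proof (rule integrable_const_bound[of _ "G * R"])
  show "AE \<omega> in M. norm (regret t \<omega>) \<le> G * R"
  proof (rule AE_I2)
    fix \<omega> assume "\<omega> \<in> space M"
    then show "norm (regret t \<omega>) \<le> G * R"
      using objective_diff_le[OF x_in[OF assms] xstar] objective_diff_le[OF xstar x_in[OF assms]]
      by (auto simp: abs_le_iff)
  qed
qed (rule regret_measurable[OF assms])

lemma excess_square_integrable:
  assumes "1 \<le> t" "t \<le> u"
  shows "integrable M (\<lambda>\<omega>. (excess t (\<omega>, \<xi> u \<omega>))\<^sup>2)"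
    and "(\<integral>\<omega>. (excess t (\<omega>, \<xi> u \<omega>))\<^sup>2 \<partial>M) \<le> 2 * G\<^sup>2 * R\<^sup>2"
proof -
  have u: "1 \<le> u" using assms by simp
  have bd: "(excess t (\<omega>, \<xi> u \<omega>))\<^sup>2 \<le> R\<^sup>2 * ((sgnorm (x t \<omega>) (\<xi> u \<omega>))\<^sup>2 + (sgnorm xstar (\<xi> u \<omega>))\<^sup>2)"
    if "\<omega> \<in> space M" for \<omega>
    using F_diff_square_le[OF x_in[OF assms(1) that] xstar \<xi>_in[OF u that]] by simp
  have i: "integrable M (\<lambda>\<omega>. R\<^sup>2 * ((sgnorm (x t \<omega>) (\<xi> u \<omega>))\<^sup>2 + (sgnorm xstar (\<xi> u \<omega>))\<^sup>2))"
    using iterate_second_moment(1)[OF assms] const_second_moment(1)[OF u xstar] by auto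
  show s: "integrable M (\<lambda>\<omega>. (excess t (\<omega>, \<xi> u \<omega>))\<^sup>2)"
    by (rule Bochner_Integration.integrable_bound[OF i])
      (use excess_measurable_M[OF assms] bd in \<open>auto intro!: AE_I2 order_trans[OF bd]\<close>)
  have "(\<integral>\<omega>. (excess t (\<omega>, \<xi> u \<omega>))\<^sup>2 \<partial>M) \<le>
      (\<integral>\<omega>. R\<^sup>2 * ((sgnorm (x t \<omega>) (\<xi> u \<omega>))\<^sup>2 + (sgnorm xstar (\<xi> u \<omega>))\<^sup>2) \<partial>M)"
    using s i bd by (rule integral_mono)
  also have "\<dots> = R\<^sup>2 * ((\<integral>\<omega>. (sgnorm (x t \<omega>) (\<xi> u \<omega>))\<^sup>2 \<partial>M) + (\<integral>\<omega>. (sgnorm xstar (\<xi> u \<omega>))\<^sup>2 \<partial>M))"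
    using iterate_second_moment(1)[OF assms] const_second_moment(1)[OF u xstar] by simp
  also have "\<dots> \<le> R\<^sup>2 * (G\<^sup>2 + G\<^sup>2)"
    using iterate_second_moment(2)[OF assms] const_second_moment(2)[OF u xstar]
    by (intro mult_left_mono add_mono) auto
  finally show "(\<integral>\<omega>. (excess t (\<omega>, \<xi> u \<omega>))\<^sup>2 \<partial>M) \<le> 2 * G\<^sup>2 * R\<^sup>2" by (simp add: algebra_simps)
qed

lemma excess_integrable:
  assumes "1 \<le> t" "t \<le> u"
  shows "integrable M (\<lambda>\<omega>. excess t (\<omega>, \<xi> u \<omega>))"
  using square_integrable_imp_integrable[OF excess_measurable_M[OF assms] excess_square_integrable(1)[OF assms]] .

text \<open>Under \<open>\<nu>\<close> the bound holds for every \<open>\<omega>\<close>, since the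
  target second moment is controlled at each point of \<open>X\<close>.\<close>

lemma excess_target_square:
  assumes "1 \<le> t" "\<omega> \<in> space M"
  shows "integrable \<nu> (\<lambda>z. (excess t (\<omega>, z))\<^sup>2)" "(\<integral>z. (excess t (\<omega>, z))\<^sup>2 \<partial>\<nu>) \<le> 2 * G\<^sup>2 * R\<^sup>2"
proof -
  note xt = x_in[OF assms]
  have bd: "(excess t (\<omega>, z))\<^sup>2 \<le> R\<^sup>2 * ((sgnorm (x t \<omega>) z)\<^sup>2 + (sgnorm xstar z)\<^sup>2)"
    if "z \<in> space \<nu>" for z
    using F_diff_square_le[OF xt xstar that] by simp
  have i: "integrable \<nu> (\<lambda>z. R\<^sup>2 * ((sgnorm (x t \<omega>) z)\<^sup>2 + (sgnorm xstar z)\<^sup>2))"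
    using target_second_moment(1)[OF xt] target_second_moment(1)[OF xstar] by auto
  have m: "(\<lambda>z. excess t (\<omega>, z)) \<in> borel_measurable \<nu>"
    using borel_measurable_integrable[OF F_int[OF xt]] borel_measurable_integrable[OF F_int[OF xstar]]
    by simp
  show s: "integrable \<nu> (\<lambda>z. (excess t (\<omega>, z))\<^sup>2)"
    by (rule Bochner_Integration.integrable_bound[OF i])
      (use m bd in \<open>auto intro!: AE_I2 order_trans[OF bd]\<close>)
  have "(\<integral>z. (excess t (\<omega>, z))\<^sup>2 \<partial>\<nu>) \<le> (\<integral>z. R\<^sup>2 * ((sgnorm (x t \<omega>) z)\<^sup>2 + (sgnorm xstar z)\<^sup>2) \<partial>\<nu>)"
    using s i bd by (rule integral_mono)
  also have "\<dots> = R\<^sup>2 * ((\<integral>z. (sgnorm (x t \<omega>) z)\<^sup>2 \<partial>\<nu>) + (\<integral>z. (sgnorm xstar z)\<^sup>2 \<partial>\<nu>))"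
    using target_second_moment(1)[OF xt] target_second_moment(1)[OF xstar] by simp
  also have "\<dots> \<le> R\<^sup>2 * (G\<^sup>2 + G\<^sup>2)"
    using target_second_moment(2)[OF xt] target_second_moment(2)[OF xstar]
    by (intro mult_left_mono add_mono) auto
  finally show "(\<integral>z. (excess t (\<omega>, z))\<^sup>2 \<partial>\<nu>) \<le> 2 * G\<^sup>2 * R\<^sup>2" by (simp add: algebra_simps)
qed

text \<open>For fixed \<open>\<omega>\<close> the Hellinger comparison leaves second moments of
  \<open>excess\<close> under the conditional law and under the target. Averaging over
  \<open>\<omega>\<close> turns the former into a moment at the actual sample
  \<open>\<xi> u\<close>; each is then at most \<open>2 * G\<^sup>2 * R\<^sup>2\<close>, which gives
  the 4 in \<open>main\<close>. The weight \<open>c\<close> is chosen after the averaging.\<close>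

lemma regret_le_excess_hel:
  assumes t: "1 \<le> t" and e: "0 < \<epsilon>" and k: "\<tau>hel \<epsilon> = Suc k"
  shows "(\<integral>\<omega>. regret t \<omega> \<partial>M) \<le> (\<integral>\<omega>. excess t (\<omega>, \<xi> (t + k) \<omega>) \<partial>M) + 3 * \<epsilon> * G * R"
proof -
  define s u where "s = t - 1" and "u = t + k"
  have su: "s + \<tau>hel \<epsilon> = u" "s < u" "t \<le> u" "1 \<le> u" using t k by (auto simp: s_def u_def)
  note ku = \<kappa>[OF su(2)]
  note kD = conditional_distributionD[OF ku]
  have m: "excess t \<in> borel_measurable (H s \<Otimes>\<^sub>M \<nu>)" using excess_measurable[OF t] by (simp add: s_def)
  note D = integral_disintegration[OF prob_space_axioms subalg \<xi>[OF su(4)] ku]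
  note D1 = D[OF m excess_integrable[OF t su(3)]]
  note D2 = D[of "\<lambda>p. (excess t p)\<^sup>2", OF borel_measurable_power[OF m] excess_square_integrable(1)[OF t su(3)]]
  have main: "(\<integral>\<omega>. regret t \<omega> \<partial>M) - (\<integral>\<omega>. excess t (\<omega>, \<xi> u \<omega>) \<partial>M) \<le> \<epsilon> * (c / 2 + 4 * (G * R)\<^sup>2 / c)"
    if c: "0 < c" for c
  proof -
    have "AE \<omega> in M. regret t \<omega> - (\<integral>z. excess t (\<omega>, z) \<partial>\<kappa> s u \<omega>)
        \<le> \<epsilon> * (c / 2 + ((\<integral>z. (excess t (\<omega>, z))\<^sup>2 \<partial>\<kappa> s u \<omega>) + 2 * G\<^sup>2 * R\<^sup>2) / c)"
      using hel(2)[unfolded mixed_at_def] D2(1) AE_space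
    proof eventually_elim
      case (elim \<omega>)
      have w: "\<omega> \<in> space (H s)" using elim by simp
      have hd: "hel_dist (\<kappa> s u \<omega>) \<nu> \<le> \<epsilon>" using elim(1) e su(1) by metis
      have mk: "(\<lambda>z. excess t (\<omega>, z)) \<in> borel_measurable (\<kappa> s u \<omega>)"
        using measurable_compose[OF measurable_Pair1'[OF w] m]
        unfolding measurable_cong_sets[OF kD(4)[OF w] refl] by simp
      have "regret t \<omega> - (\<integral>z. excess t (\<omega>, z) \<partial>\<kappa> s u \<omega>)
        \<le> \<epsilon> * (c / 2 + ((\<integral>z. (excess t (\<omega>, z))\<^sup>2 \<partial>\<kappa> s u \<omega>) + (\<integral>z. (excess t (\<omega>, z))\<^sup>2 \<partial>\<nu>)) / c)"
        unfolding regret_eq[OF t elim(3)]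
        using excess_target_square(1)[OF t elim(3)] elim(2) kD(4)[OF w] c e
        by (intro expectation_diff_le_hel_dist kD(3)[OF w] \<nu>.prob_space_axioms mk hd) auto
      also have "\<dots> \<le> \<epsilon> * (c / 2 + ((\<integral>z. (excess t (\<omega>, z))\<^sup>2 \<partial>\<kappa> s u \<omega>) + 2 * G\<^sup>2 * R\<^sup>2) / c)"
        using excess_target_square(2)[OF t elim(3)] e c
        by (intro mult_left_mono add_mono divide_right_mono) auto
      finally show ?case .
    qed
    then have "(\<integral>\<omega>. regret t \<omega> - (\<integral>z. excess t (\<omega>, z) \<partial>\<kappa> s u \<omega>) \<partial>M)
        \<le> (\<integral>\<omega>. \<epsilon> * (c / 2 + ((\<integral>z. (excess t (\<omega>, z))\<^sup>2 \<partial>\<kappa> s u \<omega>) + 2 * G\<^sup>2 * R\<^sup>2) / c) \<partial>M)"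
      by (intro integral_mono_AE) (intro Bochner_Integration.integrable_diff regret_integrable t D1(2)
        integrable_mult_right Bochner_Integration.integrable_add integrable_divide integrable_const D2(2))+
    moreover have "(\<integral>\<omega>. regret t \<omega> - (\<integral>z. excess t (\<omega>, z) \<partial>\<kappa> s u \<omega>) \<partial>M) =
        (\<integral>\<omega>. regret t \<omega> \<partial>M) - (\<integral>\<omega>. excess t (\<omega>, \<xi> u \<omega>) \<partial>M)"
      unfolding D1(3)[symmetric] by (intro Bochner_Integration.integral_diff regret_integrable t D1(2))
    moreover have "(\<integral>\<omega>. \<epsilon> * (c / 2 + ((\<integral>z. (excess t (\<omega>, z))\<^sup>2 \<partial>\<kappa> s u \<omega>) + 2 * G\<^sup>2 * R\<^sup>2) / c) \<partial>M)
        = \<epsilon> * (c / 2 + ((\<integral>\<omega>. (excess t (\<omega>, \<xi> u \<omega>))\<^sup>2 \<partial>M) + 2 * G\<^sup>2 * R\<^sup>2) / c)"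
      using D2(2,3) by (simp add: prob_space)
    moreover have "\<dots> \<le> \<epsilon> * (c / 2 + (2 * G\<^sup>2 * R\<^sup>2 + 2 * G\<^sup>2 * R\<^sup>2) / c)"
      using excess_square_integrable(2)[OF t su(3)] e c
      by (intro mult_left_mono add_mono divide_right_mono) auto
    ultimately have "(\<integral>\<omega>. regret t \<omega> \<partial>M) - (\<integral>\<omega>. excess t (\<omega>, \<xi> u \<omega>) \<partial>M)
        \<le> \<epsilon> * (c / 2 + (2 * G\<^sup>2 * R\<^sup>2 + 2 * G\<^sup>2 * R\<^sup>2) / c)"
      by linarith
    then show ?thesis by (simp add: power_mult_distrib)
  qed
  have "(\<integral>\<omega>. regret t \<omega> \<partial>M) - (\<integral>\<omega>. excess t (\<omega>, \<xi> u \<omega>) \<partial>M) \<le> 3 * \<epsilon> * G * R"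
  proof (cases "G * R = 0")
    \<comment> \<open>The weight \<open>3 * (G * R)\<close> would be 0 here. Small positive weights
      show instead that the difference is below every \<open>d > 0\<close>.\<close>
    case True
    show ?thesis
    proof (rule field_le_epsilon)
      fix d :: real assume "0 < d"
      then show "(\<integral>\<omega>. regret t \<omega> \<partial>M) - (\<integral>\<omega>. excess t (\<omega>, \<xi> u \<omega>) \<partial>M) \<le> 3 * \<epsilon> * G * R + d"
        using main[of "2 * d / \<epsilon>"] e True by auto
    qed
  next
    case False
    then have GR: "0 < G * R" using G R(1) by (simp add: less_le)
    \<comment> \<open>The optimal weight \<open>2 * sqrt 2 * G * R\<close> would give the constant
      \<open>2 * sqrt 2\<close>; the weight \<open>3 * (G * R)\<close> avoids the root and gives
      17/6, still below 3.\<close>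
    have "\<epsilon> * (3 * (G * R) / 2 + 4 * (G * R)\<^sup>2 / (3 * (G * R))) = (17 / 6) * (\<epsilon> * (G * R))"
      using GR by (simp add: power2_eq_square field_simps)
    also have "\<dots> \<le> 3 * \<epsilon> * G * R" using GR e by simp
    finally show ?thesis using main[of "3 * (G * R)"] GR by linarith
  qed
  then show ?thesis by (simp add: u_def)
qed

text \<open>The total variation comparison wants a function bounded everywhere, but
  \<open>excess\<close> is bounded by \<open>G * R\<close> only almost everywhere for
  \<open>\<nu>\<close> and almost surely along the samples. The clipped \<open>h\<close> is bounded
  everywhere and changes neither expectation: Lipschitz continuity shows this under
  \<open>\<nu>\<close>, the bound on the sampled subgradients at \<open>\<xi> u\<close>.\<close>

lemma regret_le_excess_TV:
  assumes t: "1 \<le> t" and e: "0 < \<epsilon>" and k: "\<tau>TV \<epsilon> = Suc k"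
    and lip: "AE z in \<nu>. lipschitz_over N X G (\<lambda>y. F y z)"
    and bd: "sampled_subgradients_bounded M \<xi> N X sg G"
  shows "(\<integral>\<omega>. regret t \<omega> \<partial>M) \<le> (\<integral>\<omega>. excess t (\<omega>, \<xi> (t + k) \<omega>) \<partial>M) + \<epsilon> * G * R"
proof -
  define s u where "s = t - 1" and "u = t + k"
  have su: "s + \<tau>TV \<epsilon> = u" "s < u" "t \<le> u" "1 \<le> u" using t k by (auto simp: s_def u_def)
  note ku = \<kappa>[OF su(2)]
  note kD = conditional_distributionD[OF ku]
  have m[measurable]: "excess t \<in> borel_measurable (H s \<Otimes>\<^sub>M \<nu>)"
    using excess_measurable[OF t] by (simp add: s_def)
  have GR: "0 \<le> G * R" using G R(1) by simp
  define h where "h p = max (- (G * R)) (min (G * R) (excess t p))" for p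
  have h_bd: "\<bar>h p\<bar> \<le> G * R" for p using GR by (auto simp: h_def abs_le_iff)
  have h_eq: "h p = excess t p" if "\<bar>excess t p\<bar> \<le> G * R" for p
    using that unfolding h_def by (simp add: abs_le_iff)
  have hm: "h \<in> borel_measurable (H s \<Otimes>\<^sub>M \<nu>)"
    unfolding h_def using m by (intro borel_measurable_max borel_measurable_min) auto
  have regret: "regret t \<omega> = (\<integral>z. h (\<omega>, z) \<partial>\<nu>)" if w: "\<omega> \<in> space M" for \<omega>
    unfolding regret_eq[OF t w]
  proof (rule integral_cong_AE)
    show "(\<lambda>z. excess t (\<omega>, z)) \<in> borel_measurable \<nu>" "(\<lambda>z. h (\<omega>, z)) \<in> borel_measurable \<nu>"
      using measurable_compose[OF measurable_Pair1' m] measurable_compose[OF measurable_Pair1' hm] w by auto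
    show "AE z in \<nu>. excess t (\<omega>, z) = h (\<omega>, z)"
      using lip
    proof eventually_elim
      case (elim z)
      then have "\<bar>excess t (\<omega>, z)\<bar> \<le> G * N (x t \<omega> - xstar)"
        using x_in[OF t w] xstar by (simp add: lipschitz_over_def)
      also have "\<dots> \<le> G * R" using G N_le_R[OF x_in[OF t w] xstar] by (intro mult_left_mono)
      finally show ?case by (simp add: h_eq)
    qed
  qed
  have hxm: "(\<lambda>\<omega>. h (\<omega>, \<xi> u \<omega>)) \<in> borel_measurable M"
    unfolding h_def using excess_measurable_M[OF t su(3)]
    by (intro borel_measurable_max borel_measurable_min) auto
  have hx: "(\<integral>\<omega>. h (\<omega>, \<xi> u \<omega>) \<partial>M) = (\<integral>\<omega>. excess t (\<omega>, \<xi> u \<omega>) \<partial>M)"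
  proof (rule integral_cong_AE[OF hxm excess_measurable_M[OF t su(3)]])
    show "AE \<omega> in M. h (\<omega>, \<xi> u \<omega>) = excess t (\<omega>, \<xi> u \<omega>)"
      using bd[unfolded sampled_subgradients_bounded_def] AE_space
    proof eventually_elim
      case (elim \<omega>)
      have "\<bar>excess t (\<omega>, \<xi> u \<omega>)\<bar> \<le> max (sgnorm (x t \<omega>) (\<xi> u \<omega>)) (sgnorm xstar (\<xi> u \<omega>)) * R"
        using abs_F_diff_le[OF x_in[OF t elim(2)] xstar \<xi>_in[OF su(4) elim(2)]] by simp
      also have "\<dots> \<le> G * R"
        using elim su(4) x_in[OF t elim(2)] xstar R(1) by (intro mult_right_mono) auto
      finally show ?case by (rule h_eq)
    qed
  qed
  have hint: "integrable M (\<lambda>\<omega>. h (\<omega>, \<xi> u \<omega>))"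
    using hxm h_bd by (intro integrable_const_bound[of _ "G * R"]) auto
  note D = integral_disintegration[OF prob_space_axioms subalg \<xi>[OF su(4)] ku hm hint]
  have "AE \<omega> in M. regret t \<omega> \<le> (\<integral>z. h (\<omega>, z) \<partial>\<kappa> s u \<omega>) + \<epsilon> * G * R"
    using TV(2)[unfolded mixed_at_def] AE_space
  proof eventually_elim
    case (elim \<omega>)
    have w: "\<omega> \<in> space (H s)" using elim by simp
    have tv: "tv_dist (\<kappa> s u \<omega>) \<nu> \<le> \<epsilon>" using elim(1) e su(1) by metis
    have mk: "(\<lambda>z. h (\<omega>, z)) \<in> borel_measurable (\<kappa> s u \<omega>)"
      using measurable_compose[OF measurable_Pair1'[OF w] hm]
      unfolding measurable_cong_sets[OF kD(4)[OF w] refl] by simp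
    have "regret t \<omega> - (\<integral>z. h (\<omega>, z) \<partial>\<kappa> s u \<omega>) \<le> (G * R) * tv_dist (\<kappa> s u \<omega>) \<nu>"
      unfolding regret[OF elim(2)] using kD(4)[OF w]
      by (intro expectation_diff_le_tv_dist kD(3)[OF w] \<nu>.prob_space_axioms mk h_bd) auto
    also have "\<dots> \<le> (G * R) * \<epsilon>" using tv GR by (intro mult_left_mono)
    finally show ?case by (simp add: algebra_simps)
  qed
  then have "(\<integral>\<omega>. regret t \<omega> \<partial>M) \<le> (\<integral>\<omega>. (\<integral>z. h (\<omega>, z) \<partial>\<kappa> s u \<omega>) + \<epsilon> * G * R \<partial>M)"
    by (intro integral_mono_AE regret_integrable t Bochner_Integration.integrable_add D(2) integrable_const)
  also have "\<dots> = (\<integral>\<omega>. h (\<omega>, \<xi> u \<omega>) \<partial>M) + \<epsilon> * G * R"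
    using D(2,3) by (simp add: prob_space)
  finally show ?thesis unfolding hx by (simp add: u_def)
qed

text \<open>With the sample \<open>\<xi> u\<close> fixed, \<open>x t\<close> is first replaced by
  \<open>x u\<close>, at the price of the subgradient at \<open>x t\<close> times the drift; the
  rest is the linearized regret at time \<open>u\<close>, which telescopes.\<close>

lemma delayed_excess_le:
  assumes w: "\<omega> \<in> space M" and t: "1 \<le> t"
  shows "excess t (\<omega>, \<xi> (t + k) \<omega>) \<le>
    (\<Sum>s\<in>{t..<t + k}. \<alpha> s * (((sgnorm (x t \<omega>) (\<xi> (t + k) \<omega>))\<^sup>2 + (sgnorm (x s \<omega>) (\<xi> s \<omega>))\<^sup>2) / 2))
    + sg (x (t + k) \<omega>) (\<xi> (t + k) \<omega>) \<bullet> (x (t + k) \<omega> - xstar)"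
proof -
  define u where "u = t + k"
  have u: "1 \<le> u" using t by (simp add: u_def)
  let ?a = "sgnorm (x t \<omega>) (\<xi> u \<omega>)"
  have "F (x t \<omega>) (\<xi> u \<omega>) - F (x u \<omega>) (\<xi> u \<omega>) \<le> ?a * N (x t \<omega> - x u \<omega>)"
    by (intro F_diff_le x_in t u w \<xi>_in)
  also have "\<dots> \<le> ?a * (\<Sum>s\<in>{t..<u}. \<alpha> s * sgnorm (x s \<omega>) (\<xi> s \<omega>))"
    unfolding u_def by (intro mult_left_mono x_drift[OF w t] sgnorm_nonneg)
  also have "\<dots> = (\<Sum>s\<in>{t..<u}. \<alpha> s * (?a * sgnorm (x s \<omega>) (\<xi> s \<omega>)))"
    by (simp add: sum_distrib_left algebra_simps)
  \<comment> \<open>The two dual norms belong to different times and need not be independent. AM-GM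
    leaves squares, each with mean at most G^2, because \<open>x t\<close> is chosen before
    \<open>\<xi> u\<close> and \<open>x s\<close> before \<open>\<xi> s\<close>.\<close>
  also have "\<dots> \<le> (\<Sum>s\<in>{t..<u}. \<alpha> s * ((?a\<^sup>2 + (sgnorm (x s \<omega>) (\<xi> s \<omega>))\<^sup>2) / 2))"
  proof (intro sum_mono mult_left_mono)
    fix s assume "s \<in> {t..<u}"
    then show "0 \<le> \<alpha> s" using \<alpha>(1)[of s] t by simp
    show "?a * sgnorm (x s \<omega>) (\<xi> s \<omega>) \<le> (?a\<^sup>2 + (sgnorm (x s \<omega>) (\<xi> s \<omega>))\<^sup>2) / 2"
      using sum_squares_bound[of ?a "sgnorm (x s \<omega>) (\<xi> s \<omega>)"] by simp
  qed
  finally have "F (x t \<omega>) (\<xi> u \<omega>) - F (x u \<omega>) (\<xi> u \<omega>) \<le> \<dots>" .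
  moreover have "F (x u \<omega>) (\<xi> u \<omega>) - F xstar (\<xi> u \<omega>) \<le> sg (x u \<omega>) (\<xi> u \<omega>) \<bullet> (x u \<omega> - xstar)"
    by (intro F_diff_le_inner x_in u w xstar \<xi>_in)
  ultimately show ?thesis by (simp add: u_def)
qed

text \<open>Here \<open>\<delta>\<close> is the error of one mixing comparison and \<open>k\<close>
  the delay. The drift contributes k G^2 times the sum of the stepsizes, and the terms whose delayed
  sample would come after \<open>T\<close> contribute k R G.\<close>

lemma expected_regret_bound:
  assumes T: "1 \<le> T" and "0 \<le> \<delta>"
    and mix: "\<And>t. 1 \<le> t \<Longrightarrow> (\<integral>\<omega>. regret t \<omega> \<partial>M) \<le> (\<integral>\<omega>. excess t (\<omega>, \<xi> (t + k) \<omega>) \<partial>M) + \<delta>"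
  shows "(\<integral>\<omega>. (\<Sum>t=1..T. regret t \<omega>) \<partial>M) \<le> R\<^sup>2 / (2 * \<alpha> T) + G\<^sup>2 / 2 * (\<Sum>t=1..T. \<alpha> t) + real T * \<delta>
    + real k * (G\<^sup>2 * (\<Sum>t=1..T. \<alpha> t) + R * G)"
proof -
  \<comment> \<open>Truncated subtraction: for \<open>k\<close> at least \<open>T\<close> no time
    has its delayed sample before \<open>T\<close>, \<open>n\<close> is 0, and all \<open>T\<close>
    terms fall under the crude bound.\<close>
  define n where "n = T - k"
  define Z where "Z t u \<omega> = (sgnorm (x t \<omega>) (\<xi> u \<omega>))\<^sup>2" for t u \<omega>
  have Zint: "integrable M (Z t u)" and ZG: "(\<integral>\<omega>. Z t u \<omega> \<partial>M) \<le> G\<^sup>2" if "1 \<le> t" "t \<le> u" for t u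
    using iterate_second_moment[OF that] by (simp_all add: Z_def[abs_def])
  have Z0: "0 \<le> Z t u \<omega>" for t u \<omega> by (simp add: Z_def)
  have a0: "0 \<le> \<alpha> t" if "1 \<le> t" for t using \<alpha>(1)[OF that] by simp
  define W1 where "W1 \<omega> = (\<Sum>t=1..n. \<Sum>s\<in>{t..<t + k}. \<alpha> s * ((Z t (t + k) \<omega> + Z s s \<omega>) / 2))" for \<omega>
  define W2 where "W2 \<omega> = (\<Sum>u=1..T. \<alpha> u / 2 * Z u u \<omega>)" for \<omega>
  have path: "(\<Sum>t=1..n. excess t (\<omega>, \<xi> (t + k) \<omega>)) \<le> W1 \<omega> + R\<^sup>2 / (2 * \<alpha> T) + W2 \<omega>"
    if w: "\<omega> \<in> space M" for \<omega>
  proof -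
    have "(\<Sum>t=1..n. excess t (\<omega>, \<xi> (t + k) \<omega>)) \<le>
        (\<Sum>t=1..n. (\<Sum>s\<in>{t..<t + k}. \<alpha> s * ((Z t (t + k) \<omega> + Z s s \<omega>) / 2))
          + sg (x (t + k) \<omega>) (\<xi> (t + k) \<omega>) \<bullet> (x (t + k) \<omega> - xstar))"
      unfolding Z_def by (intro sum_mono delayed_excess_le w) auto
    also have "\<dots> = W1 \<omega> + (\<Sum>t=1..n. sg (x (t + k) \<omega>) (\<xi> (t + k) \<omega>) \<bullet> (x (t + k) \<omega> - xstar))"
      by (simp add: W1_def sum.distrib)
    also have "(\<Sum>t=1..n. sg (x (t + k) \<omega>) (\<xi> (t + k) \<omega>) \<bullet> (x (t + k) \<omega> - xstar)) =
        (\<Sum>u=1 + k..n + k. sg (x u \<omega>) (\<xi> u \<omega>) \<bullet> (x u \<omega> - xstar))"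
      by (rule sum.shift_bounds_cl_nat_ivl[symmetric])
    \<comment> \<open>Either \<open>n + k = T\<close>, or \<open>T < k\<close> and both ranges are
      empty.\<close>
    also have "\<dots> = (\<Sum>u=1 + k..T. sg (x u \<omega>) (\<xi> u \<omega>) \<bullet> (x u \<omega> - xstar))"
      by (rule sum.cong) (auto simp: n_def)
    also have "\<dots> \<le> R\<^sup>2 / (2 * \<alpha> T) + (\<Sum>u=1 + k..T. \<alpha> u / 2 * Z u u \<omega>)"
      unfolding Z_def by (rule regret_telescope[OF w _ T]) simp
    also have "(\<Sum>u=1 + k..T. \<alpha> u / 2 * Z u u \<omega>) \<le> W2 \<omega>"
      unfolding W2_def by (rule sum_mono2) (auto intro!: mult_nonneg_nonneg a0 Z0)
    finally show ?thesis by simp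
  qed
  have W1: "integrable M W1" "(\<integral>\<omega>. W1 \<omega> \<partial>M) \<le> real k * (G\<^sup>2 * (\<Sum>t=1..T. \<alpha> t))"
  proof -
    have i: "integrable M (\<lambda>\<omega>. \<alpha> s * ((Z t (t + k) \<omega> + Z s s \<omega>) / 2))" if "1 \<le> t" "t \<le> s" for s t
      using Zint[of t "t + k"] Zint[of s s] that by simp
    show "integrable M W1"
      unfolding W1_def by (intro Bochner_Integration.integrable_sum i) auto
    have "(\<integral>\<omega>. W1 \<omega> \<partial>M) =
        (\<Sum>t=1..n. \<Sum>s\<in>{t..<t + k}. \<integral>\<omega>. \<alpha> s * ((Z t (t + k) \<omega> + Z s s \<omega>) / 2) \<partial>M)"
      unfolding W1_def using i
      by (subst Bochner_Integration.integral_sum, force intro!: Bochner_Integration.integrable_sum i)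
        (intro sum.cong refl Bochner_Integration.integral_sum i; auto)
    \<comment> \<open>Stepsizes do not increase, so \<open>\<alpha> s\<close> is at most
      \<open>\<alpha> t\<close> for the later times \<open>s\<close>; each \<open>t\<close> then
      carries \<open>k\<close> equal terms.\<close>
    also have "\<dots> \<le> (\<Sum>t=1..n. \<Sum>s\<in>{t..<t + k}. \<alpha> t * G\<^sup>2)"
    proof (intro sum_mono)
      fix t s assume ts: "t \<in> {1..n}" "s \<in> {t..<t + k}"
      have "(\<integral>\<omega>. \<alpha> s * ((Z t (t + k) \<omega> + Z s s \<omega>) / 2) \<partial>M) =
          \<alpha> s * (((\<integral>\<omega>. Z t (t + k) \<omega> \<partial>M) + (\<integral>\<omega>. Z s s \<omega> \<partial>M)) / 2)"
        using Zint[of t "t + k"] Zint[of s s] ts by simp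
      also have "\<dots> \<le> \<alpha> t * G\<^sup>2"
        using ZG[of t "t + k"] ZG[of s s] ts a0[of t] \<alpha>_antimono[of t s] Z0
        by (intro mult_mono) (auto intro!: add_nonneg_nonneg integral_nonneg_AE)
      finally show "(\<integral>\<omega>. \<alpha> s * ((Z t (t + k) \<omega> + Z s s \<omega>) / 2) \<partial>M) \<le> \<alpha> t * G\<^sup>2" .
    qed
    also have "\<dots> = real k * (G\<^sup>2 * (\<Sum>t=1..n. \<alpha> t))"
      by (simp add: sum_distrib_left algebra_simps)
    also have "\<dots> \<le> real k * (G\<^sup>2 * (\<Sum>t=1..T. \<alpha> t))"
      by (intro mult_left_mono sum_mono2) (auto simp: n_def intro: a0)
    finally show "(\<integral>\<omega>. W1 \<omega> \<partial>M) \<le> real k * (G\<^sup>2 * (\<Sum>t=1..T. \<alpha> t))" .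
  qed
  have W2: "integrable M W2" "(\<integral>\<omega>. W2 \<omega> \<partial>M) \<le> G\<^sup>2 / 2 * (\<Sum>t=1..T. \<alpha> t)"
  proof -
    show "integrable M W2"
      unfolding W2_def by (intro Bochner_Integration.integrable_sum integrable_mult_right Zint) auto
    have "(\<integral>\<omega>. W2 \<omega> \<partial>M) = (\<Sum>u=1..T. \<alpha> u / 2 * (\<integral>\<omega>. Z u u \<omega> \<partial>M))"
      unfolding W2_def using Zint by (subst Bochner_Integration.integral_sum) auto
    also have "\<dots> \<le> (\<Sum>u=1..T. \<alpha> u / 2 * G\<^sup>2)"
      using a0 by (intro sum_mono mult_left_mono ZG) auto
    also have "\<dots> = G\<^sup>2 / 2 * (\<Sum>t=1..T. \<alpha> t)"
      unfolding sum_distrib_left by (rule sum.cong) auto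
    finally show "(\<integral>\<omega>. W2 \<omega> \<partial>M) \<le> G\<^sup>2 / 2 * (\<Sum>t=1..T. \<alpha> t)" .
  qed
  have ei: "integrable M (\<lambda>\<omega>. excess t (\<omega>, \<xi> (t + k) \<omega>))" if "1 \<le> t" for t
    using that by (intro excess_integrable) auto
  have "(\<integral>\<omega>. (\<Sum>t=1..T. regret t \<omega>) \<partial>M) = (\<Sum>t=1..T. \<integral>\<omega>. regret t \<omega> \<partial>M)"
    by (intro Bochner_Integration.integral_sum regret_integrable) auto
  also have "\<dots> = (\<Sum>t=1..n. \<integral>\<omega>. regret t \<omega> \<partial>M) + (\<Sum>t=n+1..T. \<integral>\<omega>. regret t \<omega> \<partial>M)"
    by (subst sum.union_disjoint[symmetric]) (auto intro!: sum.cong simp: n_def)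
  \<comment> \<open>There are \<open>T - n\<close> such terms, the minimum of \<open>T\<close> and
    \<open>k\<close>.\<close>
  also have "(\<Sum>t=n+1..T. \<integral>\<omega>. regret t \<omega> \<partial>M) \<le> (\<Sum>t=n+1..T. G * R)"
  proof (rule sum_mono)
    fix t assume "t \<in> {n+1..T}"
    then have t: "1 \<le> t" by simp
    have "(\<integral>\<omega>. regret t \<omega> \<partial>M) \<le> (\<integral>\<omega>. G * R \<partial>M)"
      by (intro integral_mono regret_integrable t regret_le integrable_const)
    then show "(\<integral>\<omega>. regret t \<omega> \<partial>M) \<le> G * R" by (simp add: prob_space)
  qed
  also have "\<dots> = real (T - n) * (R * G)"
    by (simp add: mult.commute del: of_nat_diff)
  also have "\<dots> \<le> real k * (R * G)"
    using G R(1) by (intro mult_right_mono) (auto simp: n_def)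
  also have "(\<Sum>t=1..n. \<integral>\<omega>. regret t \<omega> \<partial>M) \<le> (\<Sum>t=1..n. (\<integral>\<omega>. excess t (\<omega>, \<xi> (t + k) \<omega>) \<partial>M) + \<delta>)"
    by (intro sum_mono mix) auto
  also have "\<dots> = (\<integral>\<omega>. (\<Sum>t=1..n. excess t (\<omega>, \<xi> (t + k) \<omega>)) \<partial>M) + real n * \<delta>"
    by (subst Bochner_Integration.integral_sum) (auto simp: sum.distrib intro: ei[simplified])
  also have "real n * \<delta> \<le> real T * \<delta>" using \<open>0 \<le> \<delta>\<close> by (intro mult_right_mono) (auto simp: n_def)
  also have "(\<integral>\<omega>. (\<Sum>t=1..n. excess t (\<omega>, \<xi> (t + k) \<omega>)) \<partial>M) \<le> (\<integral>\<omega>. W1 \<omega> + R\<^sup>2 / (2 * \<alpha> T) + W2 \<omega> \<partial>M)"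
    by (intro integral_mono path Bochner_Integration.integrable_add W1(1) W2(1) integrable_const
        Bochner_Integration.integrable_sum ei) auto
  also have "\<dots> = (\<integral>\<omega>. W1 \<omega> \<partial>M) + R\<^sup>2 / (2 * \<alpha> T) + (\<integral>\<omega>. W2 \<omega> \<partial>M)"
    using W1(1) W2(1) by (simp add: prob_space)
  finally show ?thesis using W1(2) W2(2) by (simp add: algebra_simps)
qed

end

section \<open>Deriving the second-moment bound from the assumptions on the subgradients\<close>

context emd_setting
begin

text \<open>Tower property: the nonnegative conditional expectation is integrated against the
  constant 1, without presupposing integrability.\<close>

lemma second_moment_of_variance:
  assumes "finite_single_step_variance M \<nu> \<xi> N X sg G"
  shows "emd_second_moment M \<nu> \<xi> X N Dom F sg \<psi> \<psi>' \<alpha> x x1 xstar \<kappa> \<tau>TV \<tau>hel R G"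
proof
  fix t y assume t: "1 \<le> t" and y: "y \<in> borel_measurable (H (t - 1))" "\<And>\<omega>. \<omega> \<in> space M \<Longrightarrow> y \<omega> \<in> X"
  interpret S: finite_measure_subalgebra M "H (t - 1)"
    using subalg by unfold_locales
  let ?f = "\<lambda>\<omega>. ennreal ((sgnorm (y \<omega>) (\<xi> t \<omega>))\<^sup>2)"
  have f: "?f \<in> borel_measurable M"
    using t y \<xi> measurable_from_subalg[OF subalg y(1)]
    by (intro measurable_compose[OF _ measurable_ennreal] borel_measurable_power sgnorm_measurable) auto
  have "(\<integral>\<^sup>+\<omega>. ?f \<omega> \<partial>M) = (\<integral>\<^sup>+\<omega>. nn_cond_exp M (H (t - 1)) ?f \<omega> \<partial>M)"
    using S.nn_cond_exp_intg[of "\<lambda>_. 1" ?f] f by simp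
  also have "\<dots> \<le> (\<integral>\<^sup>+\<omega>. ennreal (G\<^sup>2) \<partial>M)"
    using assms t y unfolding finite_single_step_variance_def by (intro nn_integral_mono_AE) blast
  also have "\<dots> = ennreal (G\<^sup>2)" by (simp add: emeasure_space_1)
  finally show "(\<integral>\<^sup>+\<omega>. ?f \<omega> \<partial>M) \<le> ennreal (G\<^sup>2)" .
qed

lemma second_moment_of_bounded:
  assumes "sampled_subgradients_bounded M \<xi> N X sg G"
  shows "emd_second_moment M \<nu> \<xi> X N Dom F sg \<psi> \<psi>' \<alpha> x x1 xstar \<kappa> \<tau>TV \<tau>hel R G"
proof
  fix t y assume t: "1 \<le> t" and y: "y \<in> borel_measurable (H (t - 1))" "\<And>\<omega>. \<omega> \<in> space M \<Longrightarrow> y \<omega> \<in> X"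
  have "AE \<omega> in M. ennreal ((sgnorm (y \<omega>) (\<xi> t \<omega>))\<^sup>2) \<le> ennreal (G\<^sup>2)"
    using assms[unfolded sampled_subgradients_bounded_def] AE_space
    by eventually_elim (use t y(2) sgnorm_nonneg in \<open>auto intro!: ennreal_leI power_mono\<close>)
  then have "(\<integral>\<^sup>+\<omega>. ennreal ((sgnorm (y \<omega>) (\<xi> t \<omega>))\<^sup>2) \<partial>M) \<le> (\<integral>\<^sup>+\<omega>. ennreal (G\<^sup>2) \<partial>M)"
    by (rule nn_integral_mono_AE)
  then show "(\<integral>\<^sup>+\<omega>. ennreal ((sgnorm (y \<omega>) (\<xi> t \<omega>))\<^sup>2) \<partial>M) \<le> ennreal (G\<^sup>2)"
    by (simp add: emeasure_space_1)
qed

end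

theorem theorem1:
  fixes M :: "'w measure" and \<nu> :: "'s measure" and \<xi> :: "nat \<Rightarrow> 'w \<Rightarrow> 's"
    and X :: "'a::euclidean_space set" and N :: "'a \<Rightarrow> real"
    and Dom :: "'s \<Rightarrow> 'a set" and F :: "'a \<Rightarrow> 's \<Rightarrow> real" and sg :: "'a \<Rightarrow> 's \<Rightarrow> 'a"
    and \<psi> :: "'a \<Rightarrow> real" and \<psi>' :: "'a \<Rightarrow> 'a"
    and \<alpha> :: "nat \<Rightarrow> real" and x :: "nat \<Rightarrow> 'w \<Rightarrow> 'a" and x1 xstar :: 'a
    and \<kappa> :: "nat \<Rightarrow> nat \<Rightarrow> 'w \<Rightarrow> 's measure" and \<tau>TV \<tau>hel :: "real \<Rightarrow> nat"
    and R G \<epsilon> :: real and T :: nat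
  assumes "prob_space M" and "prob_space \<nu>"
    and "\<And>t. t \<ge> 1 \<Longrightarrow> \<xi> t \<in> measurable M \<nu>"
    and "is_norm N"
    and "compact X" and "convex X"
    and "\<And>z. z \<in> space \<nu> \<Longrightarrow> X \<subseteq> Dom z \<and> closed_convex_fun (Dom z) (\<lambda>y. F y z)"
    and "\<And>y. y \<in> X \<Longrightarrow> integrable \<nu> (F y)"
    and "\<And>y z. y \<in> X \<Longrightarrow> z \<in> space \<nu> \<Longrightarrow> sg y z \<in> subdifferential (Dom z) (\<lambda>y. F y z) y"
    and "(\<lambda>(y, z). sg y z) \<in> borel_measurable (restrict_space borel X \<Otimes>\<^sub>M \<nu>)"
    and "prox_function N X \<psi> \<psi>'"
    and "0 \<le> R" and "\<And>y z. y \<in> X \<Longrightarrow> z \<in> X \<Longrightarrow> bregman \<psi> \<psi>' y z \<le> R\<^sup>2 / 2"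
    and "\<And>t. t \<ge> 1 \<Longrightarrow> 0 < \<alpha> t" and "\<And>t. t \<ge> 1 \<Longrightarrow> \<alpha> (Suc t) \<le> \<alpha> t"
    and "x1 \<in> X" and "emd_iterates M X \<psi> \<psi>' sg \<alpha> \<xi> x1 x"
    and "\<And>s t. s < t \<Longrightarrow> conditional_distribution M (hist M \<nu> \<xi> s) (\<xi> t) \<nu> (\<kappa> s t)"
    and "uniform_mixing_time M tv_dist \<nu> \<kappa> \<tau>TV" and "mixed_at M tv_dist \<nu> \<kappa> \<tau>TV"
    and "uniform_mixing_time M hel_dist \<nu> \<kappa> \<tau>hel" and "mixed_at M hel_dist \<nu> \<kappa> \<tau>hel"
    and "xstar \<in> X" and "0 \<le> G" and "0 < \<epsilon>" and "1 \<le> T"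
  shows "(finite_single_step_variance M \<nu> \<xi> N X sg G \<longrightarrow>
            integrable M (\<lambda>\<omega>. \<Sum>t=1..T. (objective \<nu> F (x t \<omega>) - objective \<nu> F xstar)) \<and>
            (\<integral>\<omega>. (\<Sum>t=1..T. (objective \<nu> F (x t \<omega>) - objective \<nu> F xstar)) \<partial>M)
              \<le> R\<^sup>2 / (2 * \<alpha> T) + G\<^sup>2 / 2 * (\<Sum>t=1..T. \<alpha> t) + 3 * real T * \<epsilon> * G * R
                + (real (\<tau>hel \<epsilon>) - 1) * (G\<^sup>2 * (\<Sum>t=1..T. \<alpha> t) + R * G)) \<and>
         ((AE z in \<nu>. lipschitz_over N X G (\<lambda>y. F y z)) \<and>
            sampled_subgradients_bounded M \<xi> N X sg G \<longrightarrow>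
            integrable M (\<lambda>\<omega>. \<Sum>t=1..T. (objective \<nu> F (x t \<omega>) - objective \<nu> F xstar)) \<and>
            (\<integral>\<omega>. (\<Sum>t=1..T. (objective \<nu> F (x t \<omega>) - objective \<nu> F xstar)) \<partial>M)
              \<le> R\<^sup>2 / (2 * \<alpha> T) + G\<^sup>2 / 2 * (\<Sum>t=1..T. \<alpha> t) + real T * \<epsilon> * G * R
                + (real (\<tau>TV \<epsilon>) - 1) * (G\<^sup>2 * (\<Sum>t=1..T. \<alpha> t) + R * G))"
proof -
  interpret prob_space M by fact
  interpret \<nu>: prob_space \<nu> by fact
  interpret emd_setting M \<nu> \<xi> X N Dom F sg \<psi> \<psi>' \<alpha> x x1 xstar \<kappa> \<tau>TV \<tau>hel R G
    by unfold_locales (use assms in blast)+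
  have A: "integrable M (\<lambda>\<omega>. \<Sum>t=1..T. regret t \<omega>) \<and>
      (\<integral>\<omega>. (\<Sum>t=1..T. regret t \<omega>) \<partial>M) \<le> R\<^sup>2 / (2 * \<alpha> T) + G\<^sup>2 / 2 * (\<Sum>t=1..T. \<alpha> t)
        + 3 * real T * \<epsilon> * G * R + (real (\<tau>hel \<epsilon>) - 1) * (G\<^sup>2 * (\<Sum>t=1..T. \<alpha> t) + R * G)"
    if "finite_single_step_variance M \<nu> \<xi> N X sg G"
  proof -
    interpret S: emd_second_moment M \<nu> \<xi> X N Dom F sg \<psi> \<psi>' \<alpha> x x1 xstar \<kappa> \<tau>TV \<tau>hel R G
      using that by (rule second_moment_of_variance)
    obtain k where k: "\<tau>hel \<epsilon> = Suc k"
      using mixing_time_pos[OF hel(1) \<open>0 < \<epsilon>\<close>] by (cases "\<tau>hel \<epsilon>") auto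
    have "0 \<le> 3 * \<epsilon> * G * R" using \<open>0 < \<epsilon>\<close> \<open>0 \<le> G\<close> \<open>0 \<le> R\<close> by simp
    from S.expected_regret_bound[OF \<open>1 \<le> T\<close> this S.regret_le_excess_hel[OF _ \<open>0 < \<epsilon>\<close> k]]
    show ?thesis
      using S.regret_integrable by (auto simp: k algebra_simps)
  qed
  have B: "integrable M (\<lambda>\<omega>. \<Sum>t=1..T. regret t \<omega>) \<and>
      (\<integral>\<omega>. (\<Sum>t=1..T. regret t \<omega>) \<partial>M) \<le> R\<^sup>2 / (2 * \<alpha> T) + G\<^sup>2 / 2 * (\<Sum>t=1..T. \<alpha> t)
        + real T * \<epsilon> * G * R + (real (\<tau>TV \<epsilon>) - 1) * (G\<^sup>2 * (\<Sum>t=1..T. \<alpha> t) + R * G)"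
    if "(AE z in \<nu>. lipschitz_over N X G (\<lambda>y. F y z)) \<and> sampled_subgradients_bounded M \<xi> N X sg G"
  proof -
    interpret S: emd_second_moment M \<nu> \<xi> X N Dom F sg \<psi> \<psi>' \<alpha> x x1 xstar \<kappa> \<tau>TV \<tau>hel R G
      using that by (intro second_moment_of_bounded) simp
    obtain k where k: "\<tau>TV \<epsilon> = Suc k"
      using mixing_time_pos[OF TV(1) \<open>0 < \<epsilon>\<close>] by (cases "\<tau>TV \<epsilon>") auto
    have "0 \<le> \<epsilon> * G * R" using \<open>0 < \<epsilon>\<close> \<open>0 \<le> G\<close> \<open>0 \<le> R\<close> by simp
    from S.expected_regret_bound[OF \<open>1 \<le> T\<close> this
        S.regret_le_excess_TV[OF _ \<open>0 < \<epsilon>\<close> k conjunct1[OF that] conjunct2[OF that]]]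
    show ?thesis
      using S.regret_integrable by (auto simp: k algebra_simps)
  qed
  from A B show ?thesis by blast
qed

end
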